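(* Let $d\ge1$, $T\in(0,\infty)$, $\alpha\in(0,1)$, and let $b:[0,T]\times\mathbb{T}^d\to\mathbb{R}^d$ be continuous. Let $u_0:\mathbb{T}^d\to\mathbb{R}$. Assume there are constants $C_1>0$ and $C_2>0$ such that $$|b(t,x)-b(t,y)|\le C_1|x-y|\quad\text{and}\quad |u_0(x)-u_0(y)|\le C_2|x-y|$$ for all $t\in(0,T]$ and $x,y\in\mathbb{R}^d$. Then there exists at most one viscosity solution $u\in C([0,T]\times\mathbb{T}^d)$ of the initial value problem $$\partial_t^\alpha u+b(t,x)\cdot Du=0\ \text{ in } (0,T]\times\mathbb{T}^d,\qquad u(0,\cdot)=u_0 \text{ on } \mathbb{T}^d.$$ Moreover, for such a viscosity solution $u$ there exists a constant $C_3>0$ such that $$|u(t,x)-u(s,y)|\le C_3\big(|t-s|^\alpha+|x-y|\big)$$ for all $(t,x),(s,y)\in[0,T]\times\mathbb{R}^d$.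
   Context: $\mathbb{T}^d=\mathbb{R}^d/\mathbb{Z}^d$; functions on $\mathbb{T}^d$ (resp. $[0,T]\times\mathbb{T}^d$) are identified with functions on $\mathbb{R}^d$ (resp. $[0,T]\times\mathbb{R}^d$) that are $\mathbb{Z}^d$-periodic in the space variable. Write $Q_T=(0,T]\times\mathbb{T}^d$, $\overline{Q_T}=[0,T]\times\mathbb{T}^d$. $Du$ is the spatial gradient and $\partial_t^\alpha$ is Caputo's derivative $(\partial_t^\alpha f)(t)=\frac{1}{\Gamma(1-\alpha)}\int_0^t \frac{f'(s)}{(t-s)^\alpha}ds$. Test functions: for $a<b$ and a domain $O$, $\mathcal{C}^1([a,b]\times O)=\{\phi\in C^1((a,b]\times O)\cap C([a,b]\times O): \partial_t\phi(\cdot,x)\in L^1(a,b)\ \forall x\in O\}$. For measurable $f:[0,T]\to\mathbb{R}$, $t\in(0,T]$, $r\in[0,t]$ set $J_r[f](t)=\frac{\alpha}{\Gamma(1-\alpha)}\int_0^r (f(t)-f(t-\tau))\frac{d\tau}{\tau^{\alpha+1}}$ and $K_r[f](t)=\frac{f(t)-f(0)}{t^\alpha\Gamma(1-\alpha)}+\frac{\alpha}{\Gamma(1-\alpha)}\int_r^t (f(t)-f(t-\tau))\frac{d\tau}{\tau^{\alpha+1}}$, integrals with lower limit $0$ being improper ($\lim_{\rho\searrow0}\int_\rho$); for $f(t,x)$ these act in $t$ with $x$ fixed. For a Hamiltonian $H:\overline{Q_T}\times\mathbb{R}\times\mathbb{R}^d\to\mathbb{R}$ (here $H(t,x,r,p)=b(t,x)\cdot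 p$), $u\in USC(\overline{Q_T})$ (resp. $LSC(\overline{Q_T})$) is a viscosity subsolution (resp. supersolution) of $\partial_t^\alpha u+H(t,x,u,Du)=0$ in $Q_T$ if for all $a<b$ in $[0,T]$, every open ball $B\subset\mathbb{R}^d$, every $\phi\in\mathcal{C}^1([0,T]\times\mathbb{R}^d)$ and every $(\hat t,\hat x)\in(a,b]\times B$ at which $u-\phi$ attains its maximum (resp. minimum) over $[a,b]\times\overline B$, $J_{\hat t-a}[\phi](\hat t,\hat x)+K_{\hat t-a}[u](\hat t,\hat x)+H(\hat t,\hat x,u(\hat t,\hat x),D\phi(\hat t,\hat x))\le0$ (resp. $\ge0$). A viscosity solution is a $u\in C(\overline{Q_T})$ that is both; it is a viscosity solution of the initial value problem if moreover $u(0,\cdot)=u_0$. *)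

theory Defs
  imports "HOL-Analysis.Analysis"
begin

text \<open>Points of the torus T^d are represented by vectors in real^'n (d = CARD('n));
  functions on T^d are Z^d-periodic functions on real^'n.\<close>

definition int_vec :: "real^'n \<Rightarrow> bool" where
  "int_vec k \<longleftrightarrow> (\<forall>i. k $ i \<in> \<int>)"

definition periodic_x :: "(real^'n \<Rightarrow> 'b) \<Rightarrow> bool" where
  "periodic_x f \<longleftrightarrow> (\<forall>x k. int_vec k \<longrightarrow> f (x + k) = f x)"

definition periodic_tx :: "(real \<Rightarrow> real^'n \<Rightarrow> 'b) \<Rightarrow> bool" where
  "periodic_tx f \<longleftrightarrow> (\<forall>t. periodic_x (f t))"

definition usc_on :: "('a::metric_space) set \<Rightarrow> ('a \<Rightarrow> real) \<Rightarrow> bool" where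
  "usc_on S f \<longleftrightarrow> (\<forall>z\<in>S. \<forall>e>0. \<exists>d>0. \<forall>w\<in>S. dist w z < d \<longrightarrow> f w < f z + e)"

definition lsc_on :: "('a::metric_space) set \<Rightarrow> ('a \<Rightarrow> real) \<Rightarrow> bool" where
  "lsc_on S f \<longleftrightarrow> (\<forall>z\<in>S. \<forall>e>0. \<exists>d>0. \<forall>w\<in>S. dist w z < d \<longrightarrow> f z - e < f w)"

definition imp_int :: "(real \<Rightarrow> real) \<Rightarrow> real \<Rightarrow> real \<Rightarrow> real" where
  "imp_int g lo hi =
     (if lo = 0 then Lim (at_right 0) (\<lambda>\<rho>. integral {\<rho>..hi} g) else integral {lo..hi} g)"

definition J_op :: "real \<Rightarrow> real \<Rightarrow> (real \<Rightarrow> real) \<Rightarrow> real \<Rightarrow> real" where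
  "J_op \<alpha> r f t = \<alpha> / Gamma (1 - \<alpha>) *
      imp_int (\<lambda>\<tau>. (f t - f (t - \<tau>)) * \<tau> powr (- \<alpha> - 1)) 0 r"

definition K_op :: "real \<Rightarrow> real \<Rightarrow> (real \<Rightarrow> real) \<Rightarrow> real \<Rightarrow> real" where
  "K_op \<alpha> r f t = (f t - f 0) / (t powr \<alpha> * Gamma (1 - \<alpha>)) + \<alpha> / Gamma (1 - \<alpha>) *
      imp_int (\<lambda>\<tau>. (f t - f (t - \<tau>)) * \<tau> powr (- \<alpha> - 1)) r t"

definition test_fn :: "real \<Rightarrow> (real \<Rightarrow> real^'n \<Rightarrow> real) \<Rightarrow> (real \<Rightarrow> real^'n \<Rightarrow> real)
    \<Rightarrow> (real \<Rightarrow> real^'n \<Rightarrow> real^'n) \<Rightarrow> bool" where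
  "test_fn T \<phi> \<phi>t D\<phi> \<longleftrightarrow>
     continuous_on ({0..T} \<times> UNIV) (\<lambda>(t,x). \<phi> t x) \<and>
     continuous_on ({0<..T} \<times> UNIV) (\<lambda>(t,x). \<phi>t t x) \<and>
     continuous_on ({0<..T} \<times> UNIV) (\<lambda>(t,x). D\<phi> t x) \<and>
     (\<forall>t\<in>{0<..T}. \<forall>x. ((\<lambda>(s,y). \<phi> s y) has_derivative (\<lambda>(h,k). h * \<phi>t t x + D\<phi> t x \<bullet> k))
         (at (t,x) within {0<..T} \<times> UNIV)) \<and>
     (\<forall>x. (\<lambda>t. \<phi>t t x) absolutely_integrable_on {0..T})"

definition visc_sub :: "real \<Rightarrow> real \<Rightarrow> (real \<Rightarrow> real^'n \<Rightarrow> real \<Rightarrow> real^'n \<Rightarrow> real)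
    \<Rightarrow> (real \<Rightarrow> real^'n \<Rightarrow> real) \<Rightarrow> bool" where
  "visc_sub \<alpha> T H u \<longleftrightarrow> periodic_tx u \<and> usc_on ({0..T} \<times> UNIV) (\<lambda>(t,x). u t x) \<and>
     (\<forall>a b c r \<phi> \<phi>t D\<phi> th xh. 0 \<le> a \<and> a < b \<and> b \<le> T \<and> test_fn T \<phi> \<phi>t D\<phi> \<and>
        th \<in> {a<..b} \<and> xh \<in> ball c r \<and>
        (\<forall>s\<in>{a..b}. \<forall>y\<in>cball c r. u s y - \<phi> s y \<le> u th xh - \<phi> th xh) \<longrightarrow>
        J_op \<alpha> (th - a) (\<lambda>s. \<phi> s xh) th + K_op \<alpha> (th - a) (\<lambda>s. u s xh) th
          + H th xh (u th xh) (D\<phi> th xh) \<le> 0)"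

definition visc_super :: "real \<Rightarrow> real \<Rightarrow> (real \<Rightarrow> real^'n \<Rightarrow> real \<Rightarrow> real^'n \<Rightarrow> real)
    \<Rightarrow> (real \<Rightarrow> real^'n \<Rightarrow> real) \<Rightarrow> bool" where
  "visc_super \<alpha> T H u \<longleftrightarrow> periodic_tx u \<and> lsc_on ({0..T} \<times> UNIV) (\<lambda>(t,x). u t x) \<and>
     (\<forall>a b c r \<phi> \<phi>t D\<phi> th xh. 0 \<le> a \<and> a < b \<and> b \<le> T \<and> test_fn T \<phi> \<phi>t D\<phi> \<and>
        th \<in> {a<..b} \<and> xh \<in> ball c r \<and>
        (\<forall>s\<in>{a..b}. \<forall>y\<in>cball c r. u th xh - \<phi> th xh \<le> u s y - \<phi> s y) \<longrightarrow>
        J_op \<alpha> (th - a) (\<lambda>s. \<phi> s xh) th + K_op \<alpha> (th - a) (\<lambda>s. u s xh) th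
          + H th xh (u th xh) (D\<phi> th xh) \<ge> 0)"

definition visc_sol_ivp :: "real \<Rightarrow> real \<Rightarrow> (real \<Rightarrow> real^'n \<Rightarrow> real \<Rightarrow> real^'n \<Rightarrow> real)
    \<Rightarrow> (real^'n \<Rightarrow> real) \<Rightarrow> (real \<Rightarrow> real^'n \<Rightarrow> real) \<Rightarrow> bool" where
  "visc_sol_ivp \<alpha> T H u0 u \<longleftrightarrow>
     continuous_on ({0..T} \<times> UNIV) (\<lambda>(t,x). u t x) \<and> periodic_tx u \<and>
     visc_sub \<alpha> T H u \<and> visc_super \<alpha> T H u \<and> (\<forall>x. u 0 x = u0 x)"

end

theory Submission
  imports Defs
begin

text \<open>
  Both parts follow from doubling variables. At a maximum of
  $u(t,x) - v(s,y) - L(t)\,\psi(x-y) - P(t,s)$, with $\psi$ a smoothed norm, comparing the two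
  arguments after the same backward time shift bounds the difference of the two nonlocal time
  derivatives from below, while the Lipschitz bound on $b$ controls the difference of the transport
  terms by a multiple of $C_1 L(t) \psi$.

  With $P(t,s) = k(t-s)^2$ and $L(t) = 2 C_2 e^{\mu t}$, $\mu$ large, the fractional
  derivative of $L$ (counted from the value $C_2$ at time $0$) beats this term, so
  $u(t,x) - v(t,y) \le L(t) |x-y|$ for any two solutions. Putting $x = y$ gives uniqueness, and
  $u = v$ gives the Lipschitz estimate in space.

  With this estimate the gradients occurring at a maximum are bounded. Taking $L$ constant and
  $P(t,s) = C|t-s|^\alpha$, and shifting the two times independently for shifts below $|t-s|$, the
  strict concavity of $h \mapsto h^\alpha$ makes the difference of the time derivatives at least a
  multiple of $C$, which is impossible for large $C$.
\<close>

text \<open>Up to the factor \<open>Gamma (1 - \<alpha>)\<close> this is \<open>K_op\<close>. Extending \<open>f\<close> by \<open>f 0\<close> to negative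
  times makes the range of integration independent of \<open>t\<close>, so that the operators at two different
  times can be subtracted under one integral.\<close>

definition tail_op :: "real \<Rightarrow> real \<Rightarrow> real \<Rightarrow> (real \<Rightarrow> real) \<Rightarrow> real \<Rightarrow> real" where
  "tail_op \<alpha> R r f t = (f t - f 0) * R powr (- \<alpha>)
     + \<alpha> * integral {r..R} (\<lambda>\<tau>. (f t - f (max 0 (t - \<tau>))) * \<tau> powr (- \<alpha> - 1))"

text \<open>For \<eta> > 0 this approximates the norm from above to within \<eta> and is smooth also
  at z = 0, so the penalty in x - y has a gradient even on the diagonal.\<close>

definition smooth_norm :: "real \<Rightarrow> 'a::real_inner \<Rightarrow> real" where
  "smooth_norm \<eta> z = sqrt ((norm z)\<^sup>2 + \<eta>\<^sup>2)"

lemma smooth_norm_ge_norm: "norm z \<le> smooth_norm \<eta> z"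
  unfolding smooth_norm_def by (rule real_le_rsqrt) simp

lemma smooth_norm_ge: "\<eta> \<le> smooth_norm \<eta> z"
  unfolding smooth_norm_def by (rule real_le_rsqrt) simp

lemma smooth_norm_le:
  assumes "0 \<le> \<eta>"
  shows "smooth_norm \<eta> z \<le> norm z + \<eta>"
  unfolding smooth_norm_def using assms
  by (intro real_le_lsqrt) (auto simp: power2_sum)

text \<open>Expand the nonnegative square of the difference of the two values. Equality holds at z =
  z0, so a quadratic touches the smoothed norm from above there and can replace it in test
  functions.\<close>

lemma smooth_norm_le_quadratic:
  fixes z z0 :: "'a::real_inner"
  assumes "0 < \<eta>"
  shows "smooth_norm \<eta> z \<le> smooth_norm \<eta> z0
           + ((norm z)\<^sup>2 - (norm z0)\<^sup>2) / (2 * smooth_norm \<eta> z0)"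
proof -
  have pos: "0 < smooth_norm \<eta> z0"
    using assms smooth_norm_ge[of \<eta> z0] by linarith
  have sq: "(smooth_norm \<eta> w)\<^sup>2 = (norm w)\<^sup>2 + \<eta>\<^sup>2" for w :: 'a
    by (simp add: smooth_norm_def)
  have "0 \<le> (smooth_norm \<eta> z - smooth_norm \<eta> z0)\<^sup>2"
    by simp
  then have "2 * (smooth_norm \<eta> z * smooth_norm \<eta> z0)
      \<le> 2 * (smooth_norm \<eta> z0)\<^sup>2 + ((norm z)\<^sup>2 - (norm z0)\<^sup>2)"
    unfolding power2_diff sq[of z] using sq[of z0] by (simp add: mult.assoc)
  then show ?thesis
    using pos by (simp add: field_simps power2_eq_square)
qed

subsection \<open>Calculus of the singular kernel\<close>

text \<open>Young's inequality with weights a and 1 - a for the numbers y and 1: the concave power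
  lies below its tangent at 1.\<close>

lemma powr_le_Bernoulli:
  fixes y a :: real
  assumes "0 \<le> y" "0 < a" "a < 1"
  shows "y powr a \<le> 1 + a * (y - 1)"
  using Youngs_inequality_0[of a "1 - a" y 1] assms
  by (cases "y = 0") (simp_all add: algebra_simps)

text \<open>Scaling by h turns the tangent at 1 into the tangent at h. The endpoint x = - h is
  included, which later allows the shift \<tau> = h.\<close>

lemma powr_add_le_linear:
  fixes h x a :: real
  assumes "0 < h" "- h \<le> x" "0 < a" "a < 1"
  shows "(h + x) powr a \<le> h powr a + a * h powr (a - 1) * x"
proof -
  have "((h + x) / h) powr a \<le> 1 + a * ((h + x) / h - 1)"
    using assms by (intro powr_le_Bernoulli) auto
  then have "h powr a * ((h + x) / h) powr a \<le> h powr a * (1 + a * ((h + x) / h - 1))"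
    by (intro mult_left_mono) auto
  also have "\<dots> = h powr a + a * h powr (a - 1) * x"
    using assms by (simp add: powr_diff field_simps)
  also have "h powr a * ((h + x) / h) powr a = (h + x) powr a"
    using assms by (simp add: powr_divide)
  finally show ?thesis .
qed

text \<open>Both signs of e occur: e = - \<alpha> gives the singular kernel, e = 1 - \<alpha> the
  kernel times \<tau>.\<close>

lemma has_integral_powr_minus_one:
  fixes a b e :: real
  assumes "0 < a" "a \<le> b" "e \<noteq> 0"
  shows "((\<lambda>x. x powr (e - 1)) has_integral (b powr e - a powr e) / e) {a..b}"
proof -
  have "((\<lambda>x. x powr (e - 1)) has_integral (b powr e / e - a powr e / e)) {a..b}"
  proof (rule fundamental_theorem_of_calculus[OF assms(2)])
    fix x assume "x \<in> {a..b}"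
    then have "0 < x" using assms by auto
    then have "((\<lambda>x. x powr e / e) has_real_derivative x powr (e - 1)) (at x within {a..b})"
      using assms by (auto intro!: derivative_eq_intros)
    then show "((\<lambda>x. x powr e / e) has_vector_derivative x powr (e - 1)) (at x within {a..b})"
      by (simp add: has_real_derivative_iff_has_vector_derivative)
  qed
  then show ?thesis by (simp add: diff_divide_distrib)
qed

lemma integral_powr_kernel:
  fixes a b \<alpha> :: real
  assumes "0 < a" "a \<le> b" "0 < \<alpha>"
  shows "((\<lambda>x. x powr (- \<alpha> - 1)) has_integral (a powr (- \<alpha>) - b powr (- \<alpha>)) / \<alpha>) {a..b}"
proof -
  have "(b powr (- \<alpha>) - a powr (- \<alpha>)) / (- \<alpha>) = (a powr (- \<alpha>) - b powr (- \<alpha>)) / \<alpha>"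
    using assms by (simp add: field_simps)
  then show ?thesis
    using has_integral_powr_minus_one[of a b "- \<alpha>"] assms by simp
qed

text \<open>Since the integrand is nonnegative, the integral may be cut down to
  \<open>{a..b}\<close>, where c times the kernel integrates explicitly.\<close>

lemma integral_kernel_ge:
  fixes G :: "real \<Rightarrow> real"
  assumes "0 < \<alpha>" "0 < r" "r \<le> a" "a \<le> b" "b \<le> R"
    and int: "(\<lambda>\<tau>. G \<tau> * \<tau> powr (- \<alpha> - 1)) integrable_on {r..R}"
    and nonneg: "\<And>\<tau>. \<tau> \<in> {r..R} \<Longrightarrow> 0 \<le> G \<tau>"
    and ge: "\<And>\<tau>. \<tau> \<in> {a..b} \<Longrightarrow> c \<le> G \<tau>"
  shows "c * (a powr (- \<alpha>) - b powr (- \<alpha>))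
           \<le> \<alpha> * integral {r..R} (\<lambda>\<tau>. G \<tau> * \<tau> powr (- \<alpha> - 1))"
proof -
  let ?g = "\<lambda>\<tau>. G \<tau> * \<tau> powr (- \<alpha> - 1)"
  have sub: "{a..b} \<subseteq> {r..R}" using assms by auto
  have int': "?g integrable_on {a..b}"
    using integrable_on_subinterval[OF int sub] .
  have hi: "((\<lambda>\<tau>. c * \<tau> powr (- \<alpha> - 1)) has_integral
      c * ((a powr (- \<alpha>) - b powr (- \<alpha>)) / \<alpha>)) {a..b}"
    using assms by (intro has_integral_mult_right integral_powr_kernel) auto
  have "c * ((a powr (- \<alpha>) - b powr (- \<alpha>)) / \<alpha>) \<le> integral {a..b} ?g"
    by (rule has_integral_le[OF hi integrable_integral[OF int']])
       (auto intro!: mult_right_mono ge)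
  also have "\<dots> \<le> integral {r..R} ?g"
    using sub int' int nonneg by (intro integral_subset_le) auto
  finally have "\<alpha> * (c * ((a powr (- \<alpha>) - b powr (- \<alpha>)) / \<alpha>)) \<le> \<alpha> * integral {r..R} ?g"
    using assms(1) by (intro mult_left_mono) auto
  then show ?thesis using assms(1) by simp
qed

lemma continuous_on_kernel_integrand:
  fixes f :: "real \<Rightarrow> real"
  assumes "continuous_on {0..R} f" "0 < r" "0 \<le> t" "t \<le> R"
  shows "continuous_on {r..R} (\<lambda>\<tau>. (f t - f (max 0 (t - \<tau>))) * \<tau> powr (- \<alpha> - 1))"
proof -
  have "continuous_on {r..R} (f \<circ> (\<lambda>\<tau>. max 0 (t - \<tau>)))"
    using assms
    by (intro continuous_on_compose continuous_intros continuous_on_subset[OF assms(1)]) auto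
  then have "continuous_on {r..R} (\<lambda>\<tau>. f (max 0 (t - \<tau>)))"
    by (simp add: o_def)
  then show ?thesis
    using assms by (intro continuous_intros) auto
qed

text \<open>Beyond \<tau> = t the extended function is constantly \<open>f 0\<close>, and
  integrating the kernel over \<open>{t..R}\<close> exchanges the factor
  \<open>R powr (- \<alpha>)\<close> for \<open>t powr (- \<alpha>)\<close>.\<close>

lemma tail_op_eq_K_op:
  fixes f :: "real \<Rightarrow> real"
  assumes "0 < \<alpha>" "\<alpha> < 1" "continuous_on {0..R} f" "0 < r" "r \<le> t" "t \<le> R"
  shows "tail_op \<alpha> R r f t = Gamma (1 - \<alpha>) * K_op \<alpha> r f t"
proof -
  let ?g = "\<lambda>\<tau>. (f t - f (max 0 (t - \<tau>))) * \<tau> powr (- \<alpha> - 1)"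
  have int: "?g integrable_on {r..R}"
    using assms by (intro integrable_continuous_interval continuous_on_kernel_integrand) auto
  have split: "integral {r..R} ?g = integral {r..t} ?g + integral {t..R} ?g"
    using Henstock_Kurzweil_Integration.integral_combine[OF assms(5,6) int] by simp
  have 1: "integral {r..t} ?g = integral {r..t} (\<lambda>\<tau>. (f t - f (t - \<tau>)) * \<tau> powr (- \<alpha> - 1))"
    by (rule integral_cong) (simp add: max_def)
  have "integral {t..R} ?g = integral {t..R} (\<lambda>\<tau>. (f t - f 0) * \<tau> powr (- \<alpha> - 1))"
    by (rule integral_cong) (simp add: max_absorb1)
  also have "\<dots> = (f t - f 0) * ((t powr (- \<alpha>) - R powr (- \<alpha>)) / \<alpha>)"
    using assms by (intro integral_unique has_integral_mult_right integral_powr_kernel) auto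
  finally have 2: "\<alpha> * integral {t..R} ?g = (f t - f 0) * (t powr (- \<alpha>) - R powr (- \<alpha>))"
    using assms by simp
  define g where "g = Gamma (1 - \<alpha>)"
  have g: "0 < g" unfolding g_def using assms by (intro Gamma_real_pos) auto
  have "tail_op \<alpha> R r f t = (f t - f 0) * t powr (- \<alpha>) + \<alpha> * integral {r..t} ?g"
    unfolding tail_op_def split using 2 by (simp add: algebra_simps)
  also have "\<dots> = g * ((f t - f 0) / (t powr \<alpha> * g) + \<alpha> / g * integral {r..t} ?g)"
    using g assms by (simp add: powr_minus field_simps)
  also have "\<dots> = Gamma (1 - \<alpha>) * K_op \<alpha> r f t"
    unfolding K_op_def imp_int_def 1 g_def using assms by simp
  finally show ?thesis .
qed

subsection \<open>Testing viscosity solutions\<close>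

text \<open>The increment of the function is c \<tau>, which weakens the singularity to the power -
  \<alpha>. This is integrable at 0 because \<alpha> < 1, so the improper integral
  converges.\<close>

lemma J_op_affine:
  assumes "0 < \<alpha>" "\<alpha> < 1" "0 < r"
  shows "J_op \<alpha> r (\<lambda>s. c * s + d) t = \<alpha> / Gamma (1 - \<alpha>) * (c * r powr (1 - \<alpha>) / (1 - \<alpha>))"
proof -
  let ?g = "\<lambda>\<tau>. (c * t + d - (c * (t - \<tau>) + d)) * \<tau> powr (- \<alpha> - 1)"
  have int: "integral {\<rho>..r} ?g = c * ((r powr (1 - \<alpha>) - \<rho> powr (1 - \<alpha>)) / (1 - \<alpha>))"
    if "0 < \<rho>" "\<rho> < r" for \<rho>
  proof -
    have "integral {\<rho>..r} ?g = integral {\<rho>..r} (\<lambda>\<tau>. c * \<tau> powr (1 - \<alpha> - 1))"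
    proof (rule integral_cong)
      fix \<tau> assume "\<tau> \<in> {\<rho>..r}"
      then have "0 < \<tau>" using that by auto
      then show "?g \<tau> = c * \<tau> powr (1 - \<alpha> - 1)"
        by (simp add: powr_diff algebra_simps)
    qed
    also have "\<dots> = c * ((r powr (1 - \<alpha>) - \<rho> powr (1 - \<alpha>)) / (1 - \<alpha>))"
      using that assms
      by (intro integral_unique has_integral_mult_right has_integral_powr_minus_one) auto
    finally show ?thesis .
  qed
  have "((\<lambda>\<rho>. \<rho> powr (1 - \<alpha>)) \<longlongrightarrow> 0) (at_right 0)"
    using assms by (intro tendsto_zero_powrI[where b = "1 - \<alpha>"] tendsto_const)
      (auto simp: eventually_at_filter tendsto_ident_at)
  then have "((\<lambda>\<rho>. c * ((r powr (1 - \<alpha>) - \<rho> powr (1 - \<alpha>)) / (1 - \<alpha>))) \<longlongrightarrow>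
      c * ((r powr (1 - \<alpha>) - 0) / (1 - \<alpha>))) (at_right 0)"
    using assms by (intro tendsto_intros) auto
  moreover have "\<forall>\<^sub>F \<rho> in at_right 0.
      integral {\<rho>..r} ?g = c * ((r powr (1 - \<alpha>) - \<rho> powr (1 - \<alpha>)) / (1 - \<alpha>))"
    unfolding eventually_at_right_field using assms(3) int by (intro exI[of _ r] conjI allI impI) auto
  ultimately have "((\<lambda>\<rho>. integral {\<rho>..r} ?g) \<longlongrightarrow> c * ((r powr (1 - \<alpha>) - 0) / (1 - \<alpha>))) (at_right 0)"
    by (subst tendsto_cong)
  then have "Lim (at_right 0) (\<lambda>\<rho>. integral {\<rho>..r} ?g) = c * r powr (1 - \<alpha>) / (1 - \<alpha>)"
    by (simp add: tendsto_Lim)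
  then show ?thesis
    unfolding J_op_def imp_int_def by simp
qed

text \<open>These test functions, affine in time and quadratic in space, are the ones used
  throughout.\<close>

lemma test_fn_affine_quadratic:
  fixes w :: "real^'n"
  shows "test_fn T (\<lambda>s y. c * s + q * (norm (y - w))\<^sup>2) (\<lambda>s y. c) (\<lambda>s y. (2 * q) *\<^sub>R (y - w))"
  unfolding test_fn_def
proof (intro conjI ballI allI)
  fix t x
  show "((\<lambda>(s, y). c * s + q * (norm (y - w))\<^sup>2) has_derivative
      (\<lambda>(h, k). h * c + (2 * q) *\<^sub>R (x - w) \<bullet> k)) (at (t, x) within {0<..T} \<times> UNIV)"
    unfolding case_prod_unfold power2_norm_eq_inner
    by (auto intro!: derivative_eq_intros simp: inner_commute algebra_simps)
  show "(\<lambda>t. c) absolutely_integrable_on {0..T}"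
    by (simp add: absolutely_integrable_on_const)
qed (unfold case_prod_unfold; intro continuous_intros)+

text \<open>The test window is \<open>[t - r, t]\<close>, so only times before \<open>t\<close> matter and a one-sided linear bound in time
  suffices; the right-hand side, the contribution of \<open>J_op\<close>, vanishes as \<open>r\<close> tends to \<open>0\<close>.\<close>

lemma visc_sub_tail_op:
  fixes u :: "real \<Rightarrow> real^'n \<Rightarrow> real"
  assumes \<alpha>: "0 < \<alpha>" "\<alpha> < 1"
    and cont: "continuous_on ({0..T} \<times> UNIV) (\<lambda>(t,x). u t x)"
    and sub: "visc_sub \<alpha> T H u"
    and t: "t \<in> {0<..T}" and r: "0 < r" "r \<le> t"
    and le: "\<And>s y. s \<in> {0..t} \<Longrightarrow>
      u s y \<le> u t x + m * (t - s) + q * ((norm (y - w))\<^sup>2 - (norm (x - w))\<^sup>2)"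
  shows "tail_op \<alpha> T r (\<lambda>s. u s x) t + Gamma (1 - \<alpha>) * H t x (u t x) ((2 * q) *\<^sub>R (x - w))
           \<le> \<alpha> * m / (1 - \<alpha>) * r powr (1 - \<alpha>)"
proof -
  \<comment> \<open>This is the assumed upper bound up to an additive constant. The slope is
    \<open>- m\<close> because the bound grows as s moves back from t.\<close>
  let ?\<phi> = "\<lambda>s y. (- m) * s + q * (norm (y - w))\<^sup>2"
  have G: "Gamma (1 - \<alpha>) > 0" using \<alpha> by (intro Gamma_real_pos) auto
  have "continuous_on {0..T} ((\<lambda>(t,x). u t x) \<circ> (\<lambda>s. (s, x)))"
    by (intro continuous_on_compose continuous_intros continuous_on_subset[OF cont]) auto
  then have contx: "continuous_on {0..T} (\<lambda>s. u s x)"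
    by (simp add: o_def)
  have "\<forall>s\<in>{t - r..t}. \<forall>y\<in>cball x 1. u s y - ?\<phi> s y \<le> u t x - ?\<phi> t x"
  proof (intro ballI)
    fix s y assume "s \<in> {t - r..t}"
    then show "u s y - ?\<phi> s y \<le> u t x - ?\<phi> t x"
      using le[of s y] r by (simp add: algebra_simps)
  qed
  then have "J_op \<alpha> (t - (t - r)) (\<lambda>s. ?\<phi> s x) t + K_op \<alpha> (t - (t - r)) (\<lambda>s. u s x) t
      + H t x (u t x) ((2 * q) *\<^sub>R (x - w)) \<le> 0"
    using t r test_fn_affine_quadratic[of T "- m" q w]
    by (intro sub[unfolded visc_sub_def, THEN conjunct2, THEN conjunct2, THEN spec, THEN spec, THEN spec,
          THEN spec, THEN spec, THEN spec, THEN spec, THEN spec, THEN spec, THEN mp,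
          of "t - r" t ?\<phi> "\<lambda>s y. - m" "\<lambda>s y. (2 * q) *\<^sub>R (y - w)" t x x 1]) auto
  then have "K_op \<alpha> r (\<lambda>s. u s x) t + H t x (u t x) ((2 * q) *\<^sub>R (x - w))
      \<le> \<alpha> * m / (1 - \<alpha>) * r powr (1 - \<alpha>) / Gamma (1 - \<alpha>)"
    using J_op_affine[OF \<alpha> r(1), of "- m" "q * (norm (x - w))\<^sup>2" t]
    by (simp add: mult.commute)
  then show ?thesis
    using tail_op_eq_K_op[OF \<alpha> contx r] t
    by (simp only: pos_le_divide_eq[OF G]) (simp add: distrib_left mult.commute)
qed

text \<open>The mirror image, with a test function touching from below. Writing the gradient with
  \<open>w - x\<close> makes it agree with the subsolution gradient when the roles of the two points
  are exchanged in the doubling argument.\<close>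

lemma visc_super_tail_op:
  fixes u :: "real \<Rightarrow> real^'n \<Rightarrow> real"
  assumes \<alpha>: "0 < \<alpha>" "\<alpha> < 1"
    and cont: "continuous_on ({0..T} \<times> UNIV) (\<lambda>(t,x). u t x)"
    and super: "visc_super \<alpha> T H u"
    and t: "t \<in> {0<..T}" and r: "0 < r" "r \<le> t"
    and ge: "\<And>s y. s \<in> {0..t} \<Longrightarrow>
      u t x - m * (t - s) - q * ((norm (y - w))\<^sup>2 - (norm (x - w))\<^sup>2) \<le> u s y"
  shows "- (\<alpha> * m / (1 - \<alpha>) * r powr (1 - \<alpha>))
           \<le> tail_op \<alpha> T r (\<lambda>s. u s x) t + Gamma (1 - \<alpha>) * H t x (u t x) ((2 * q) *\<^sub>R (w - x))"
proof -
  let ?\<phi> = "\<lambda>s y. m * s + (- q) * (norm (y - w))\<^sup>2"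
  have G: "Gamma (1 - \<alpha>) > 0" using \<alpha> by (intro Gamma_real_pos) auto
  have "continuous_on {0..T} ((\<lambda>(t,x). u t x) \<circ> (\<lambda>s. (s, x)))"
    by (intro continuous_on_compose continuous_intros continuous_on_subset[OF cont]) auto
  then have contx: "continuous_on {0..T} (\<lambda>s. u s x)"
    by (simp add: o_def)
  have "\<forall>s\<in>{t - r..t}. \<forall>y\<in>cball x 1. u t x - ?\<phi> t x \<le> u s y - ?\<phi> s y"
  proof (intro ballI)
    fix s y assume "s \<in> {t - r..t}"
    then show "u t x - ?\<phi> t x \<le> u s y - ?\<phi> s y"
      using ge[of s y] r by (simp add: algebra_simps)
  qed
  then have "J_op \<alpha> (t - (t - r)) (\<lambda>s. ?\<phi> s x) t + K_op \<alpha> (t - (t - r)) (\<lambda>s. u s x) t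
      + H t x (u t x) ((2 * (- q)) *\<^sub>R (x - w)) \<ge> 0"
    using t r test_fn_affine_quadratic[of T m "- q" w]
    by (intro super[unfolded visc_super_def, THEN conjunct2, THEN conjunct2, THEN spec, THEN spec, THEN spec,
          THEN spec, THEN spec, THEN spec, THEN spec, THEN spec, THEN spec, THEN mp,
          of "t - r" t ?\<phi> "\<lambda>s y. m" "\<lambda>s y. (2 * (- q)) *\<^sub>R (y - w)" t x x 1]) auto
  moreover have "(2 * (- q)) *\<^sub>R (x - w) = (2 * q) *\<^sub>R (w - x)"
    by (simp add: scaleR_diff_right)
  ultimately have "- (\<alpha> * m / (1 - \<alpha>) * r powr (1 - \<alpha>)) / Gamma (1 - \<alpha>)
      \<le> K_op \<alpha> r (\<lambda>s. u s x) t + H t x (u t x) ((2 * q) *\<^sub>R (w - x))"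
    using J_op_affine[OF \<alpha> r(1), of m "- q * (norm (x - w))\<^sup>2" t]
    by (simp add: mult.commute)
  then show ?thesis
    using tail_op_eq_K_op[OF \<alpha> contx r] t
    by (simp only: pos_divide_le_eq[OF G]) (simp add: distrib_left mult.commute)
qed

subsection \<open>Periodic functions and doubling of variables\<close>

lemma int_vec_translate_unit_cube:
  fixes x :: "real^'n"
  obtains k where "int_vec k" "x + k \<in> cbox 0 1"
proof
  show "int_vec (\<chi> i. - of_int \<lfloor>x $ i\<rfloor> :: real^'n)"
    by (simp add: int_vec_def)
  show "x + (\<chi> i. - of_int \<lfloor>x $ i\<rfloor>) \<in> cbox 0 1"
    unfolding mem_box_cart by (auto; linarith)
qed

lemma periodic_tx_add: "periodic_tx f \<Longrightarrow> int_vec k \<Longrightarrow> f t (x + k) = f t x"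
  by (simp add: periodic_tx_def periodic_x_def)

lemma periodic_tx_bounded:
  fixes f :: "real \<Rightarrow> real^'n \<Rightarrow> 'b::real_normed_vector"
  assumes cont: "continuous_on ({0..T} \<times> UNIV) (\<lambda>(t,x). f t x)" and per: "periodic_tx f"
  obtains M where "0 < M" "\<And>t x. t \<in> {0..T} \<Longrightarrow> norm (f t x) \<le> M"
proof -
  let ?K = "{0..T} \<times> cbox 0 (1 :: real^'n)"
  have "compact ((\<lambda>(t,x). f t x) ` ?K)"
    by (intro compact_continuous_image compact_Times continuous_on_subset[OF cont]) auto
  then obtain M where M: "0 < M" "\<And>z. z \<in> (\<lambda>(t,x). f t x) ` ?K \<Longrightarrow> norm z \<le> M"
    using bounded_pos compact_imp_bounded by metis
  show ?thesis
  proof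
    fix t and x :: "real^'n" assume t: "t \<in> {0..T}"
    obtain k where k: "int_vec k" and "x + k \<in> cbox 0 1"
      using int_vec_translate_unit_cube .
    then have "f t (x + k) \<in> (\<lambda>(t,x). f t x) ` ?K"
      using t by force
    then have "norm (f t (x + k)) \<le> M"
      by (rule M(2))
    then show "norm (f t x) \<le> M"
      using periodic_tx_add[OF per k] by simp
  qed (rule M)
qed

text \<open>Uniform continuity on the compact set of times and unit cube carries over by
  periodicity, because one integer translation serves both times.\<close>

lemma periodic_tx_equicontinuous:
  fixes f :: "real \<Rightarrow> real^'n \<Rightarrow> 'b::metric_space"
  assumes cont: "continuous_on ({0..T} \<times> UNIV) (\<lambda>(t,x). f t x)" and per: "periodic_tx f"
    and "0 < e"
  obtains d where "0 < d"
    "\<And>t s x. t \<in> {0..T} \<Longrightarrow> s \<in> {0..T} \<Longrightarrow> \<bar>t - s\<bar> < d \<Longrightarrow> dist (f t x) (f s x) < e"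
proof -
  let ?K = "{0..T} \<times> cbox 0 (1 :: real^'n)"
  have "uniformly_continuous_on ?K (\<lambda>(t,x). f t x)"
    by (intro compact_uniformly_continuous compact_Times continuous_on_subset[OF cont]) auto
  then obtain d where d: "0 < d"
    "\<And>z z'. z \<in> ?K \<Longrightarrow> z' \<in> ?K \<Longrightarrow> dist z' z < d \<Longrightarrow>
      dist ((\<lambda>(t,x). f t x) z') ((\<lambda>(t,x). f t x) z) < e"
    using \<open>0 < e\<close> unfolding uniformly_continuous_on_def by metis
  show ?thesis
  proof
    fix t s and x :: "real^'n" assume ts: "t \<in> {0..T}" "s \<in> {0..T}" "\<bar>t - s\<bar> < d"
    obtain k where k: "int_vec k" "x + k \<in> cbox 0 1"
      using int_vec_translate_unit_cube .
    then have "dist (f t (x + k)) (f s (x + k)) < e"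
      using d(2)[of "(s, x + k)" "(t, x + k)"] ts by (simp add: dist_Pair_Pair dist_real_def)
    then show "dist (f t x) (f s x) < e"
      using periodic_tx_add[OF per k(1)] by simp
  qed (rule d)
qed

text \<open>The weight \<open>L\<close> depends on the first time only. Hence moving
  \<open>s\<close> alone changes the penalty only through \<open>P\<close>.\<close>

definition doubled :: "(real \<Rightarrow> real^'n \<Rightarrow> real) \<Rightarrow> (real \<Rightarrow> real^'n \<Rightarrow> real) \<Rightarrow> (real \<Rightarrow> real)
    \<Rightarrow> (real \<Rightarrow> real \<Rightarrow> real) \<Rightarrow> real \<Rightarrow> real \<Rightarrow> real \<Rightarrow> real^'n \<Rightarrow> real^'n \<Rightarrow> real" where
  "doubled u v L P \<eta> t s x y = u t x - v s y - L t * smooth_norm \<eta> (x - y) - P t s"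

text \<open>Translating x and y by a common integer vector leaves the value unchanged, and a
  positive value bounds the distance of x and y because \<open>L\<close> is at least l. So the
  search for a positive maximum takes place on a compact set.\<close>

lemma doubled_attains_max:
  fixes u v :: "real \<Rightarrow> real^'n \<Rightarrow> real"
  assumes contu: "continuous_on ({0..T} \<times> UNIV) (\<lambda>(t,x). u t x)" and peru: "periodic_tx u"
    and contv: "continuous_on ({0..T} \<times> UNIV) (\<lambda>(t,x). v t x)" and perv: "periodic_tx v"
    and contL: "continuous_on {0..T} L" and L: "0 < l" "\<And>t. t \<in> {0..T} \<Longrightarrow> l \<le> L t"
    and contP: "continuous_on ({0..T} \<times> {0..T}) (\<lambda>(t,s). P t s)"
    and P: "\<And>t s. t \<in> {0..T} \<Longrightarrow> s \<in> {0..T} \<Longrightarrow> 0 \<le> P t s"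
    and pos: "t0 \<in> {0..T}" "s0 \<in> {0..T}" "0 < doubled u v L P \<eta> t0 s0 x0 y0"
  obtains t s x y where "t \<in> {0..T}" "s \<in> {0..T}" "0 < doubled u v L P \<eta> t s x y"
    "\<And>t' s' x' y'. t' \<in> {0..T} \<Longrightarrow> s' \<in> {0..T} \<Longrightarrow>
        doubled u v L P \<eta> t' s' x' y' \<le> doubled u v L P \<eta> t s x y"
proof -
  obtain Mu where Mu: "0 < Mu" "\<And>t x. t \<in> {0..T} \<Longrightarrow> norm (u t x) \<le> Mu"
    using periodic_tx_bounded[OF contu peru] by blast
  obtain Mv where Mv: "0 < Mv" "\<And>t x. t \<in> {0..T} \<Longrightarrow> norm (v t x) \<le> Mv"
    using periodic_tx_bounded[OF contv perv] by blast
  obtain D where D: "\<And>x. x \<in> cbox 0 (1::real^'n) \<Longrightarrow> norm x \<le> D"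
    using bounded_cbox bounded_iff by metis
  \<comment> \<open>\<open>D\<close> bounds the unit cube, where x is placed, and the second term
    bounds \<open>norm (x - y)\<close> at positive values.\<close>
  define R where "R = D + (Mu + Mv) / l"
  let ?K = "{0..T} \<times> {0..T} \<times> cbox 0 (1::real^'n) \<times> cball (0::real^'n) R"
  let ?F = "\<lambda>(t,s,x,y). doubled u v L P \<eta> t s x y"
  have reduce: "\<exists>x' y'. x' \<in> cbox 0 1 \<and> y' \<in> cball 0 R
      \<and> doubled u v L P \<eta> t s x y = doubled u v L P \<eta> t s x' y'"
    if ts: "t \<in> {0..T}" "s \<in> {0..T}" and p: "0 < doubled u v L P \<eta> t s x y" for t s x y
  proof -
    obtain k where k: "int_vec k" "x + k \<in> cbox 0 1"
      using int_vec_translate_unit_cube .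
    have "l * norm (x - y) \<le> L t * smooth_norm \<eta> (x - y)"
      using L ts by (intro mult_mono smooth_norm_ge_norm) (auto intro: order_trans[of 0 l])
    also have "\<dots> < Mu + Mv"
      using p P[OF ts] Mu(2)[OF ts(1), of x] Mv(2)[OF ts(2), of y] unfolding doubled_def by auto
    finally have "norm (x - y) \<le> (Mu + Mv) / l"
      using L(1) by (simp add: field_simps)
    moreover have "norm (y + k) \<le> norm (x + k) + norm (x - y)"
      using norm_triangle_ineq4[of "x + k" "x - y"] by (simp add: algebra_simps)
    ultimately have "y + k \<in> cball 0 R"
      using D[OF k(2)] by (simp add: R_def)
    moreover have "doubled u v L P \<eta> t s (x + k) (y + k) = doubled u v L P \<eta> t s x y"
      by (simp add: doubled_def periodic_tx_add[OF peru k(1)] periodic_tx_add[OF perv k(1)])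
    ultimately show ?thesis using k(2) by metis
  qed
  have cu: "continuous_on ?K (\<lambda>z. u (fst z) (fst (snd (snd z))))"
    using continuous_on_compose2[OF contu, of ?K "\<lambda>z. (fst z, fst (snd (snd z)))"]
    by (force intro!: continuous_intros)
  have cv: "continuous_on ?K (\<lambda>z. v (fst (snd z)) (snd (snd (snd z))))"
    using continuous_on_compose2[OF contv, of ?K "\<lambda>z. (fst (snd z), snd (snd (snd z)))"]
    by (force intro!: continuous_intros)
  have cL: "continuous_on ?K (\<lambda>z. L (fst z))"
    by (rule continuous_on_compose2[OF contL]) (auto intro!: continuous_intros)
  have cP: "continuous_on ?K (\<lambda>z. P (fst z) (fst (snd z)))"
    using continuous_on_compose2[OF contP, of ?K "\<lambda>z. (fst z, fst (snd z))"]
    by (force intro!: continuous_intros)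
  have "continuous_on ?K ?F"
    unfolding doubled_def case_prod_unfold smooth_norm_def
    by (intro continuous_intros cu cv cL cP)
  moreover have "compact ?K"
    by (intro compact_Times) auto
  moreover obtain x1 y1 where 1: "x1 \<in> cbox 0 1" "y1 \<in> cball 0 R"
      "doubled u v L P \<eta> t0 s0 x0 y0 = doubled u v L P \<eta> t0 s0 x1 y1"
    using reduce[OF pos] by blast
  then have in1: "(t0, s0, x1, y1) \<in> ?K" using pos by auto
  ultimately obtain z where z: "z \<in> ?K" "\<forall>w\<in>?K. ?F w \<le> ?F z"
    using continuous_attains_sup[of ?K ?F] by blast
  obtain t s x y where z_eq: "z = (t, s, x, y)" by (cases z)
  have pos': "0 < doubled u v L P \<eta> t s x y"
    using z(2) in1 1 pos z_eq by force
  show ?thesis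
  proof
    show "t \<in> {0..T}" "s \<in> {0..T}" using z z_eq by auto
    show "0 < doubled u v L P \<eta> t s x y" by (rule pos')
    fix t' s' x' y' assume ts: "t' \<in> {0..T}" "s' \<in> {0..T}"
    show "doubled u v L P \<eta> t' s' x' y' \<le> doubled u v L P \<eta> t s x y"
    proof (cases "0 < doubled u v L P \<eta> t' s' x' y'")
      case True
      then obtain x2 y2 where "x2 \<in> cbox 0 1" "y2 \<in> cball 0 R"
          "doubled u v L P \<eta> t' s' x' y' = doubled u v L P \<eta> t' s' x2 y2"
        using reduce[OF ts] by blast
      then show ?thesis using z(2) ts z_eq by force
    qed (use pos' in linarith)
  qed
qed

text \<open>Freezing s and y turns the maximum into an upper bound for u. Monotonicity of
  \<open>L\<close> allows its value at t to be used for all earlier times, and the smoothed norm is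
  replaced by its touching quadratic.\<close>

lemma doubled_max_subsolution:
  fixes u v :: "real \<Rightarrow> real^'n \<Rightarrow> real"
  assumes \<alpha>: "0 < \<alpha>" "\<alpha> < 1"
    and cont: "continuous_on ({0..T} \<times> UNIV) (\<lambda>(t,x). u t x)"
    and sub: "visc_sub \<alpha> T H u"
    and \<eta>: "0 < \<eta>"
    and L: "0 \<le> L t" "\<And>t'. t' \<in> {0..t} \<Longrightarrow> L t' \<le> L t"
    and P: "\<And>t'. t' \<in> {0..t} \<Longrightarrow> P t' s \<le> P t s + m * (t - t')"
    and max: "\<And>t' s' x' y'. t' \<in> {0..T} \<Longrightarrow> s' \<in> {0..T} \<Longrightarrow>
        doubled u v L P \<eta> t' s' x' y' \<le> doubled u v L P \<eta> t s x y"
    and t: "t \<in> {0<..T}" and s: "s \<in> {0..T}" and r: "0 < r" "r \<le> t"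
  shows "tail_op \<alpha> T r (\<lambda>s. u s x) t
           + Gamma (1 - \<alpha>) * H t x (u t x) ((L t / smooth_norm \<eta> (x - y)) *\<^sub>R (x - y))
         \<le> \<alpha> * m / (1 - \<alpha>) * r powr (1 - \<alpha>)"
proof -
  let ?\<psi> = "smooth_norm \<eta> (x - y)"
  \<comment> \<open>With this coefficient the gradient of the quadratic at x equals that of
    \<open>L t\<close> times the smoothed norm.\<close>
  let ?q = "L t / (2 * ?\<psi>)"
  have "u t' z \<le> u t x + m * (t - t') + ?q * ((norm (z - y))\<^sup>2 - (norm (x - y))\<^sup>2)"
    if t': "t' \<in> {0..t}" for t' z
  proof -
    have "u t' z - L t' * smooth_norm \<eta> (z - y) - P t' s \<le> u t x - L t * ?\<psi> - P t s"
      using max[of t' s z y] t' t s by (simp add: doubled_def)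
    moreover have "L t' * smooth_norm \<eta> (z - y) \<le> L t * smooth_norm \<eta> (z - y)"
      using L(2)[OF t'] \<eta> smooth_norm_ge[of \<eta> "z - y"] by (intro mult_right_mono) auto
    moreover have "L t * smooth_norm \<eta> (z - y)
        \<le> L t * (?\<psi> + ((norm (z - y))\<^sup>2 - (norm (x - y))\<^sup>2) / (2 * ?\<psi>))"
      using L(1) smooth_norm_le_quadratic[OF \<eta>] by (intro mult_left_mono)
    ultimately show ?thesis
      using P[OF t'] by (simp add: distrib_left)
  qed
  from visc_sub_tail_op[OF \<alpha> cont sub t r this] show ?thesis
    by simp
qed

text \<open>Here t and x are frozen, so the weight stays \<open>L t\<close>. The gradient is the
  same vector as in the subsolution inequality, so subtracting the two leaves only the difference of
  the drifts.\<close>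

lemma doubled_max_supersolution:
  fixes u v :: "real \<Rightarrow> real^'n \<Rightarrow> real"
  assumes \<alpha>: "0 < \<alpha>" "\<alpha> < 1"
    and cont: "continuous_on ({0..T} \<times> UNIV) (\<lambda>(t,x). v t x)"
    and super: "visc_super \<alpha> T H v"
    and \<eta>: "0 < \<eta>"
    and L: "0 \<le> L t"
    and P: "\<And>s'. s' \<in> {0..s} \<Longrightarrow> P t s' \<le> P t s + m * (s - s')"
    and max: "\<And>t' s' x' y'. t' \<in> {0..T} \<Longrightarrow> s' \<in> {0..T} \<Longrightarrow>
        doubled u v L P \<eta> t' s' x' y' \<le> doubled u v L P \<eta> t s x y"
    and t: "t \<in> {0..T}" and s: "s \<in> {0<..T}" and r: "0 < r" "r \<le> s"
  shows "- (\<alpha> * m / (1 - \<alpha>) * r powr (1 - \<alpha>))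
         \<le> tail_op \<alpha> T r (\<lambda>s. v s y) s
           + Gamma (1 - \<alpha>) * H s y (v s y) ((L t / smooth_norm \<eta> (x - y)) *\<^sub>R (x - y))"
proof -
  let ?\<psi> = "smooth_norm \<eta> (x - y)"
  let ?q = "L t / (2 * ?\<psi>)"
  have "v s y - m * (s - s') - ?q * ((norm (z - x))\<^sup>2 - (norm (y - x))\<^sup>2) \<le> v s' z"
    if s': "s' \<in> {0..s}" for s' z
  proof -
    have "- v s' z - L t * smooth_norm \<eta> (x - z) - P t s' \<le> - v s y - L t * ?\<psi> - P t s"
      using max[of t s' x z] s' t s by (simp add: doubled_def)
    moreover have "L t * smooth_norm \<eta> (x - z)
        \<le> L t * (?\<psi> + ((norm (x - z))\<^sup>2 - (norm (x - y))\<^sup>2) / (2 * ?\<psi>))"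
      using L(1) smooth_norm_le_quadratic[OF \<eta>] by (intro mult_left_mono)
    ultimately show ?thesis
      using P[OF s'] by (simp add: distrib_left norm_minus_commute)
  qed
  from visc_super_tail_op[OF \<alpha> cont super s r this] show ?thesis
    by simp
qed

section \<open>Estimates for comparing the two equations at a maximum\<close>

lemma norm_smooth_norm_gradient_le:
  assumes "0 < \<eta>" "0 \<le> c"
  shows "norm ((c / smooth_norm \<eta> z) *\<^sub>R z) \<le> c"
proof -
  have "0 < smooth_norm \<eta> z" using smooth_norm_ge[of \<eta> z] assms by linarith
  moreover have "c * norm z \<le> c * smooth_norm \<eta> z"
    using smooth_norm_ge_norm assms by (intro mult_left_mono) auto
  ultimately show ?thesis using assms by (simp add: pos_divide_le_eq)
qed

text \<open>Both operators integrate over the same range, so they subtract under one integral.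
  Nonnegativity lets the integral be restricted to \<open>{a..b}\<close>, while the boundary terms
  at R stay explicit.\<close>

lemma tail_op_diff_ge:
  fixes f g :: "real \<Rightarrow> real"
  assumes \<alpha>: "0 < \<alpha>" and f: "continuous_on {0..R} f" and g: "continuous_on {0..R} g"
    and r: "0 < r" "r \<le> a" "a \<le> b" "b \<le> R" and t: "t \<in> {0..R}" and s: "s \<in> {0..R}"
    and nonneg: "\<And>\<tau>. \<tau> \<in> {r..R} \<Longrightarrow>
      0 \<le> f t - f (max 0 (t - \<tau>)) - (g s - g (max 0 (s - \<tau>)))"
    and ge: "\<And>\<tau>. \<tau> \<in> {a..b} \<Longrightarrow>
      c \<le> f t - f (max 0 (t - \<tau>)) - (g s - g (max 0 (s - \<tau>)))"
  shows "c * (a powr (- \<alpha>) - b powr (- \<alpha>)) + (f t - f 0 - (g s - g 0)) * R powr (- \<alpha>)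
           \<le> tail_op \<alpha> R r f t - tail_op \<alpha> R r g s"
proof -
  let ?F = "\<lambda>\<tau>. (f t - f (max 0 (t - \<tau>))) * \<tau> powr (- \<alpha> - 1)"
  let ?G = "\<lambda>\<tau>. (g s - g (max 0 (s - \<tau>))) * \<tau> powr (- \<alpha> - 1)"
  let ?D = "\<lambda>\<tau>. (f t - f (max 0 (t - \<tau>)) - (g s - g (max 0 (s - \<tau>)))) * \<tau> powr (- \<alpha> - 1)"
  have F: "?F integrable_on {r..R}"
    using t r by (intro integrable_continuous_interval continuous_on_kernel_integrand f) auto
  have G: "?G integrable_on {r..R}"
    using s r by (intro integrable_continuous_interval continuous_on_kernel_integrand g) auto
  have D: "?D = (\<lambda>\<tau>. ?F \<tau> - ?G \<tau>)"
    by (simp add: fun_eq_iff left_diff_distrib)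
  have "?D integrable_on {r..R}"
    unfolding D by (intro integrable_diff F G)
  then have "c * (a powr (- \<alpha>) - b powr (- \<alpha>)) \<le> \<alpha> * integral {r..R} ?D"
    by (rule integral_kernel_ge[OF \<alpha> r]) (use nonneg ge in auto)
  also have "integral {r..R} ?D = integral {r..R} ?F - integral {r..R} ?G"
    unfolding D by (intro integral_diff F G)
  finally show ?thesis
    unfolding tail_op_def right_diff_distrib left_diff_distrib[of "f t - f 0"] by linarith
qed

text \<open>The constant extension to negative times makes all increments at time 0 vanish. This
  replaces the equation when one point of a maximum lies at the initial time.\<close>

lemma tail_op_zero [simp]: "0 < r \<Longrightarrow> tail_op \<alpha> R r f 0 = 0"
proof -
  assume "0 < r"
  then have "integral {r..R} (\<lambda>\<tau>. (f 0 - f (max 0 (0 - \<tau>))) * \<tau> powr (- \<alpha> - 1))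
      = integral {r..R} (\<lambda>\<tau>. 0)"
    by (intro integral_cong) (auto simp: max_absorb1)
  then show ?thesis by (simp add: tail_op_def)
qed

text \<open>This chooses the window length r for which the contribution of \<open>J_op\<close> falls
  below a given threshold.\<close>

lemma small_powr:
  fixes K X e \<rho> :: real
  assumes "0 < X" "0 < e" "0 < \<rho>"
  obtains r where "0 < r" "r \<le> \<rho>" "K * r powr e < X"
proof -
  define r where "r = min \<rho> ((X / (\<bar>K\<bar> + 1)) powr (1 / e))"
  have r: "0 < r" "r \<le> \<rho>" using assms by (auto simp: r_def)
  have "r powr e \<le> ((X / (\<bar>K\<bar> + 1)) powr (1 / e)) powr e"
    using r assms by (intro powr_mono2) (auto simp: r_def)
  also have "\<dots> = X / (\<bar>K\<bar> + 1)"
    using assms by (simp add: powr_powr)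
  finally have "(\<bar>K\<bar> + 1) * r powr e \<le> X"
    by (simp add: pos_le_divide_eq mult.commute)
  moreover have "K * r powr e < (\<bar>K\<bar> + 1) * r powr e"
    using r by (intro mult_strict_right_mono) auto
  ultimately show ?thesis using that[OF r] by linarith
qed

text \<open>Shifting both times back by \<tau> and truncating at 0 does not move them apart, so a
  penalty increasing in their distance cannot grow.\<close>

lemma abs_max_diff_le: "\<bar>max 0 (t - \<tau>) - max 0 (s - \<tau>)\<bar> \<le> \<bar>t - s\<bar>" for t s \<tau> :: real
  by auto

subsection \<open>Comparison and the Lipschitz estimate in space\<close>

text \<open>The two lower bounds serve times above and below \<open>2 / \<mu>\<close>: for the former the kernel is integrated over
  \<open>[1 / \<mu>, 2 / \<mu>]\<close>, for the latter the gain comes from the jump of the initial value.\<close>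

lemma doubling_rate_exists:
  fixes \<alpha> K :: real
  assumes "0 < \<alpha>" "0 < K"
  obtains \<mu> where "0 < \<mu>" "K \<le> \<mu> powr \<alpha> * (1 - 2 powr (- \<alpha>))" "K \<le> (\<mu> / 3) powr \<alpha>"
proof -
  \<comment> \<open>Both lower bounds are multiples of \<open>\<mu> powr \<alpha>\<close>. Here
    \<kappa> is the smaller factor, and \<mu> will solve
    \<open>\<mu> powr \<alpha> * \<kappa> = K\<close>.\<close>
  define \<kappa> where "\<kappa> = min (1 - 2 powr (- \<alpha>)) ((1 / 3) powr \<alpha>)"
  have "(2::real) powr (- \<alpha>) < 2 powr 0" using assms by (intro powr_less_mono) auto
  then have \<kappa>: "0 < \<kappa>" by (simp add: \<kappa>_def)
  define \<mu> where "\<mu> = (K / \<kappa>) powr (1 / \<alpha>)"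
  have \<mu>: "\<mu> powr \<alpha> = K / \<kappa>" using assms \<kappa> by (simp add: \<mu>_def powr_powr)
  show ?thesis
  proof
    show "0 < \<mu>" using assms \<kappa> by (simp add: \<mu>_def)
    have "K / \<kappa> * \<kappa> \<le> K / \<kappa> * (1 - 2 powr (- \<alpha>))"
      using assms \<kappa> by (intro mult_left_mono) (auto simp: \<kappa>_def)
    then show "K \<le> \<mu> powr \<alpha> * (1 - 2 powr (- \<alpha>))" using \<kappa> \<mu> by simp
    have "K / \<kappa> * \<kappa> \<le> K / \<kappa> * (1 / 3) powr \<alpha>"
      using assms \<kappa> by (intro mult_left_mono) (auto simp: \<kappa>_def)
    also have "\<dots> = (\<mu> / 3) powr \<alpha>"
      using \<open>0 < \<mu>\<close> by (simp add: \<mu>[symmetric] powr_divide)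
    finally show "K \<le> (\<mu> / 3) powr \<alpha>" using \<kappa> by simp
  qed
qed

text \<open>At a positive maximum the two equations bound the difference of the tail operators
  strictly above by \<open>3 * (\<Gamma> * C1 * (L t * \<psi>))\<close>, whereas the growth of
  \<open>L\<close> bounds it below by the same quantity.\<close>

lemma spatial_comparison:
  fixes u v :: "real \<Rightarrow> real^'n \<Rightarrow> real" and b :: "real \<Rightarrow> real^'n \<Rightarrow> real^'n"
  assumes T: "0 < T" and \<alpha>: "0 < \<alpha>" "\<alpha> < 1"
    and contb: "continuous_on ({0..T} \<times> UNIV) (\<lambda>(t,x). b t x)" and perb: "periodic_tx b"
    and C: "0 < C1" "0 < C2"
    and lipb: "\<And>t x y. t \<in> {0<..T} \<Longrightarrow> norm (b t x - b t y) \<le> C1 * norm (x - y)"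
    and contu: "continuous_on ({0..T} \<times> UNIV) (\<lambda>(t,x). u t x)" and peru: "periodic_tx u"
    and contv: "continuous_on ({0..T} \<times> UNIV) (\<lambda>(t,x). v t x)" and perv: "periodic_tx v"
    and sub: "visc_sub \<alpha> T (\<lambda>t x r p. b t x \<bullet> p) u"
    and super: "visc_super \<alpha> T (\<lambda>t x r p. b t x \<bullet> p) v"
    and init: "\<And>x y. u 0 x - v 0 y \<le> C2 * norm (x - y)"
  obtains \<Lambda> where "0 < \<Lambda>" "\<And>t x y. t \<in> {0..T} \<Longrightarrow> u t x - v t y \<le> \<Lambda> * norm (x - y)"
proof -
  define \<Gamma> where "\<Gamma> = Gamma (1 - \<alpha>)"
  have \<Gamma>: "0 < \<Gamma>" unfolding \<Gamma>_def using \<alpha> by (intro Gamma_real_pos) auto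
  have "0 < 6 * \<Gamma> * C1" using \<Gamma> C by simp
  then obtain \<mu> where \<mu>: "0 < \<mu>" "6 * \<Gamma> * C1 \<le> \<mu> powr \<alpha> * (1 - 2 powr (- \<alpha>))"
      "6 * \<Gamma> * C1 \<le> (\<mu> / 3) powr \<alpha>"
    using doubling_rate_exists[OF \<alpha>(1)] by metis
  define L where "L t = 2 * C2 * exp (\<mu> * t)" for t
  have L_mono: "L t \<le> L t'" if "t \<le> t'" for t t' using that C \<mu> by (simp add: L_def)
  have L_ge: "2 * C2 \<le> L t" if "0 \<le> t" for t using L_mono[OF that] by (simp add: L_def)
  have L_pos: "0 < L t" for t using C by (simp add: L_def)
  have "u t0 x0 - v t0 y0 \<le> L T * norm (x0 - y0)" if t0: "t0 \<in> {0..T}" for t0 x0 y0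
  proof (rule ccontr)
    assume "\<not> ?thesis"
    then have gap: "0 < u t0 x0 - v t0 y0 - L T * norm (x0 - y0)" by simp
    \<comment> \<open>Smoothing the norm costs at most \<open>L T * \<eta>\<close>, which is half of
      the gap.\<close>
    define \<eta> where "\<eta> = (u t0 x0 - v t0 y0 - L T * norm (x0 - y0)) / (2 * L T)"
    have \<eta>: "0 < \<eta>" using gap L_pos by (simp add: \<eta>_def)
    have "L t0 * smooth_norm \<eta> (x0 - y0) \<le> L T * (norm (x0 - y0) + \<eta>)"
      using L_mono[of t0 T] t0 L_pos[of T] \<eta> smooth_norm_ge[of \<eta> "x0 - y0"]
      by (intro mult_mono smooth_norm_le) auto
    also have "\<dots> < u t0 x0 - v t0 y0"
    proof -
      have "L T * \<eta> = (u t0 x0 - v t0 y0 - L T * norm (x0 - y0)) / 2"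
        using L_pos[of T] by (simp add: \<eta>_def)
      then show ?thesis using gap by (simp add: distrib_left)
    qed
    finally have pos0: "L t0 * smooth_norm \<eta> (x0 - y0) < u t0 x0 - v t0 y0" .
    \<comment> \<open>The tolerances are multiples of \<eta>, which is at most \<psi>, so errors
      from differing times are absorbed by \<open>C2 * \<psi>\<close> and
      \<open>C1 * \<psi>\<close>.\<close>
    obtain dv where dv: "0 < dv" "\<And>t s x. t \<in> {0..T} \<Longrightarrow> s \<in> {0..T} \<Longrightarrow> \<bar>t - s\<bar> < dv \<Longrightarrow>
        dist (v t x) (v s x) < C2 * \<eta>"
      using periodic_tx_equicontinuous[OF contv perv, of "C2 * \<eta>"] C \<eta>
      by (metis mult_pos_pos)
    obtain du where du: "0 < du" "\<And>t s x. t \<in> {0..T} \<Longrightarrow> s \<in> {0..T} \<Longrightarrow> \<bar>t - s\<bar> < du \<Longrightarrow>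
        dist (u t x) (u s x) < C2 * \<eta>"
      using periodic_tx_equicontinuous[OF contu peru, of "C2 * \<eta>"] C \<eta>
      by (metis mult_pos_pos)
    obtain db where db: "0 < db" "\<And>t s x. t \<in> {0..T} \<Longrightarrow> s \<in> {0..T} \<Longrightarrow> \<bar>t - s\<bar> < db \<Longrightarrow>
        dist (b t x) (b s x) < C1 * \<eta>"
      using periodic_tx_equicontinuous[OF contb perb, of "C1 * \<eta>"] C \<eta>
      by (metis mult_pos_pos)
    obtain Mu where Mu: "0 < Mu" "\<And>t x. t \<in> {0..T} \<Longrightarrow> norm (u t x) \<le> Mu"
      using periodic_tx_bounded[OF contu peru] by blast
    obtain Mv where Mv: "0 < Mv" "\<And>t x. t \<in> {0..T} \<Longrightarrow> norm (v t x) \<le> Mv"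
      using periodic_tx_bounded[OF contv perv] by blast
    define d where "d = min (min (min du dv) db) (1 / \<mu>)"
    have d: "0 < d" "d \<le> du" "d \<le> dv" "d \<le> db" "d \<le> 1 / \<mu>" using du dv db \<mu> by (auto simp: d_def)
    \<comment> \<open>Positivity of the maximum gives
      \<open>k * (t - s)\<^sup>2 < Mu + Mv = k * d\<^sup>2\<close>, so this k forces the two times
      to lie closer than d.\<close>
    define k where "k = (Mu + Mv) / d\<^sup>2"
    have k: "0 < k" using Mu Mv d by (simp add: k_def)
    define P where "P t s = k * (t - s)\<^sup>2" for t s :: real
    have "doubled u v L P \<eta> t0 t0 x0 y0 > 0"
      using pos0 by (simp add: doubled_def P_def)
    moreover have "continuous_on {0..T} L" "continuous_on ({0..T} \<times> {0..T}) (\<lambda>(t,s). P t s)"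
      unfolding L_def P_def case_prod_unfold by (intro continuous_intros)+
    moreover have "0 \<le> P t s" for t s using k by (simp add: P_def)
    ultimately obtain t s x y where ts: "t \<in> {0..T}" "s \<in> {0..T}"
      and pos: "0 < doubled u v L P \<eta> t s x y"
      and max: "\<And>t' s' x' y'. t' \<in> {0..T} \<Longrightarrow> s' \<in> {0..T} \<Longrightarrow>
        doubled u v L P \<eta> t' s' x' y' \<le> doubled u v L P \<eta> t s x y"
      using doubled_attains_max[OF contu peru contv perv, of L "2 * C2" P t0 t0 \<eta> x0 y0] C L_ge t0
      by (metis (no_types, lifting) atLeastAtMost_iff mult_pos_pos zero_less_numeral)
    define \<psi> where "\<psi> = smooth_norm \<eta> (x - y)"
    have \<psi>: "\<eta> \<le> \<psi>" "norm (x - y) \<le> \<psi>" "0 < \<psi>"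
      using smooth_norm_ge[of \<eta> "x - y"] smooth_norm_ge_norm[of "x - y" \<eta>] \<eta> by (auto simp: \<psi>_def)
    have uv: "L t * \<psi> + k * (t - s)\<^sup>2 < u t x - v s y"
      using pos by (simp add: doubled_def P_def \<psi>_def)
    then have uv': "L t * \<psi> < u t x - v s y"
      using k by (smt (verit) mult_nonneg_nonneg zero_le_power2)
    have C2_\<psi>: "C2 * norm (x - y) \<le> C2 * \<psi>" "C2 * \<eta> \<le> C2 * \<psi>" "2 * C2 * \<psi> \<le> L t * \<psi>"
      using C \<psi> L_ge[of t] ts by (auto intro!: mult_mono)
    have "0 < L t * \<psi>" using L_pos \<psi> by simp
    then have "k * (t - s)\<^sup>2 < Mu + Mv"
      using uv Mu(2)[OF ts(1), of x] Mv(2)[OF ts(2), of y] by auto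
    also have "Mu + Mv = k * d\<^sup>2" using d by (simp add: k_def)
    finally have "(t - s)\<^sup>2 < d\<^sup>2" by (simp only: mult_less_cancel_left_pos[OF k])
    then have "\<bar>t - s\<bar>\<^sup>2 < d\<^sup>2" by (simp only: power2_abs)
    then have close: "\<bar>t - s\<bar> < d"
      by (rule power2_less_imp_less) (use d(1) in simp)
    \<comment> \<open>At t = 0 the initial Lipschitz bound and the modulus of v give less than
      \<open>2 * C2 * \<psi>\<close>, which is at most \<open>L t * \<psi>\<close>. The factor 2 in
      \<open>L\<close> leaves room for the second error; s = 0 is alike.\<close>
    have t_pos: "0 < t"
    proof (rule ccontr)
      assume "\<not> 0 < t"
      then have z: "t = 0" using ts by simp
      then have "\<bar>v s y - v 0 y\<bar> < C2 * \<eta>"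
        using dv(2)[of s 0 y] close d ts by (simp add: dist_real_def)
      moreover have "u 0 x - v 0 y \<le> C2 * norm (x - y)" by (rule init)
      ultimately show False
        using uv' C2_\<psi> unfolding z by linarith
    qed
    have s_pos: "0 < s"
    proof (rule ccontr)
      assume "\<not> 0 < s"
      then have z: "s = 0" using ts by simp
      then have "\<bar>u t x - u 0 x\<bar> < C2 * \<eta>"
        using du(2)[of t 0 x] close d ts by (simp add: dist_real_def)
      moreover have "u 0 x - v 0 y \<le> C2 * norm (x - y)" by (rule init)
      ultimately show False
        using uv' C2_\<psi> unfolding z by linarith
    qed
    \<comment> \<open>The derivative of the quadratic penalty is at most \<open>2 * k * T\<close> on
      the time interval, so this is an admissible backward slope.\<close>
    define m where "m = 2 * k * T"
    have sq_le: "k * (a - c)\<^sup>2 \<le> k * (e - c)\<^sup>2 + m * (e - a)"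
      if "a \<in> {0..e}" "e \<in> {0..T}" "c \<in> {0..T}" for a c e
    proof -
      have "(a - c)\<^sup>2 - (e - c)\<^sup>2 = (e - a) * (2 * c - a - e)"
        by (simp add: power2_eq_square algebra_simps)
      also have "\<dots> \<le> (e - a) * (2 * T)"
        using that by (intro mult_left_mono) auto
      finally have "k * ((a - c)\<^sup>2 - (e - c)\<^sup>2) \<le> k * ((e - a) * (2 * T))"
        using k by (intro mult_left_mono) auto
      then show ?thesis by (simp add: m_def algebra_simps)
    qed
    \<comment> \<open>The two \<open>J_op\<close> contributions together cost less than one unit
      \<open>\<Gamma> * C1 * (L t * \<psi>)\<close>, and the drift costs two. The bound r \<le> 1 /
      \<mu> keeps the later integration window inside the range.\<close>
    have "0 < \<Gamma> * C1 * (L t * \<psi>) / 2" using \<Gamma> C L_pos \<psi> by simp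
    moreover have "0 < min (1 / \<mu>) (min t s)" using \<mu> t_pos s_pos by simp
    ultimately obtain r where r: "0 < r" "r \<le> min (1 / \<mu>) (min t s)"
      and small: "\<alpha> * m / (1 - \<alpha>) * r powr (1 - \<alpha>) < \<Gamma> * C1 * (L t * \<psi>) / 2"
      using small_powr[of _ "1 - \<alpha>"] \<alpha> by (metis diff_gt_0_iff_gt)
    let ?f = "\<lambda>s. u s x" and ?g = "\<lambda>s. v s y"
    let ?p = "(L t / smooth_norm \<eta> (x - y)) *\<^sub>R (x - y)"
    have lo: "tail_op \<alpha> T r ?f t + \<Gamma> * (b t x \<bullet> ?p) \<le> \<alpha> * m / (1 - \<alpha>) * r powr (1 - \<alpha>)"
      unfolding \<Gamma>_def
      using doubled_max_subsolution[OF \<alpha> contu sub \<eta>, of L t P s m v x y] max ts t_pos r L_mono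
        less_imp_le[OF L_pos] sq_le[of _ t s]
      by (simp add: P_def)
    have hi: "- (\<alpha> * m / (1 - \<alpha>) * r powr (1 - \<alpha>)) \<le> tail_op \<alpha> T r ?g s + \<Gamma> * (b s y \<bullet> ?p)"
      unfolding \<Gamma>_def
      using doubled_max_supersolution[OF \<alpha> contv super \<eta>, of L t s P m u x y] max ts s_pos r
        less_imp_le[OF L_pos] sq_le[of _ s t]
      by (simp add: P_def power2_commute)
    \<comment> \<open>First change the time at fixed y, then the point at time t. Each change costs
      at most \<open>C1 * \<psi>\<close>.\<close>
    have "norm (b s y - b t x) \<le> norm (b s y - b t y) + norm (b t y - b t x)"
      using norm_triangle_ineq[of "b s y - b t y" "b t y - b t x"] by simp
    also have "\<dots> \<le> C1 * \<eta> + C1 * norm (x - y)"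
      using db(2)[of s t y] ts close d lipb[of t y x] t_pos
      by (intro add_mono) (auto simp: dist_norm abs_minus_commute norm_minus_commute)
    also have "\<dots> \<le> 2 * C1 * \<psi>"
      using mult_left_mono[OF \<psi>(1) less_imp_le[OF C(1)]] mult_left_mono[OF \<psi>(2) less_imp_le[OF C(1)]]
      by linarith
    finally have "norm (b s y - b t x) * norm ?p \<le> (2 * C1 * \<psi>) * L t"
      using norm_smooth_norm_gradient_le[OF \<eta> less_imp_le[OF L_pos]] C \<psi>
      by (intro mult_mono) auto
    then have "(b s y - b t x) \<bullet> ?p \<le> (2 * C1 * \<psi>) * L t"
      using norm_cauchy_schwarz order_trans by blast
    then have "\<Gamma> * ((b s y - b t x) \<bullet> ?p) \<le> \<Gamma> * ((2 * C1 * \<psi>) * L t)"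
      using \<Gamma> by (intro mult_left_mono) auto
    also have "\<dots> = 2 * (\<Gamma> * C1 * (L t * \<psi>))"
      by (simp only: ac_simps)
    finally have "tail_op \<alpha> T r ?f t - tail_op \<alpha> T r ?g s < 3 * (\<Gamma> * C1 * (L t * \<psi>))"
      using lo hi small unfolding inner_diff_left right_diff_distrib[of \<Gamma>] by linarith
    moreover
    let ?G = "\<lambda>\<tau>. ?f t - ?f (max 0 (t - \<tau>)) - (?g s - ?g (max 0 (s - \<tau>)))"
    \<comment> \<open>Shifting both times by the same \<tau> does not increase \<open>P\<close>, so
      only the change of the weight \<open>L\<close> remains.\<close>
    have G_ge: "(L t - L (max 0 (t - \<tau>))) * \<psi> \<le> ?G \<tau>" if "0 \<le> \<tau>" for \<tau>
    proof -
      have "(max 0 (t - \<tau>) - max 0 (s - \<tau>))\<^sup>2 \<le> (t - s)\<^sup>2"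
        using abs_max_diff_le by (simp only: abs_le_square_iff[symmetric])
      then have "k * (max 0 (t - \<tau>) - max 0 (s - \<tau>))\<^sup>2 \<le> k * (t - s)\<^sup>2"
        using k by (intro mult_left_mono) auto
      then show ?thesis
        using max[of "max 0 (t - \<tau>)" "max 0 (s - \<tau>)" x y] that ts
        by (simp add: doubled_def P_def \<psi>_def left_diff_distrib)
    qed
    have nonneg: "0 \<le> ?G \<tau>" if "\<tau> \<in> {r..T}" for \<tau>
    proof -
      have "0 \<le> (L t - L (max 0 (t - \<tau>))) * \<psi>"
        using that r \<psi> ts L_mono[of "max 0 (t - \<tau>)" t] by (intro mult_nonneg_nonneg) auto
      then show ?thesis using G_ge[of \<tau>] that r by auto
    qed
    have cf: "continuous_on {0..T} ?f"
      using continuous_on_compose2[OF contu, of "{0..T}" "\<lambda>s. (s, x)"]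
      by (force intro!: continuous_intros)
    have cg: "continuous_on {0..T} ?g"
      using continuous_on_compose2[OF contv, of "{0..T}" "\<lambda>s. (s, y)"]
      by (force intro!: continuous_intros)
    define c where "c = L t * \<psi> / 2"
    have c: "0 < c" using L_pos \<psi> by (simp add: c_def)
    have initial: "c \<le> u t x - u 0 x - (v s y - v 0 y)"
      using init[of x y] uv' C2_\<psi> by (simp add: c_def)
    have "3 * (\<Gamma> * C1 * (L t * \<psi>)) \<le> tail_op \<alpha> T r ?f t - tail_op \<alpha> T r ?g s"
    proof (cases "2 / \<mu> \<le> t")
      case True
      \<comment> \<open>Going back by at least 1 / \<mu> halves \<open>L\<close>, since exp z \<ge>
        1 + z. As \<tau> \<le> 2 / \<mu> \<le> t, the shifted time is not truncated.\<close>
      have ge: "c \<le> ?G \<tau>" if \<tau>: "\<tau> \<in> {1 / \<mu>..2 / \<mu>}" for \<tau>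
      proof -
        have \<tau>_pos: "0 < \<tau>" using \<tau> \<mu> by (auto intro: less_le_trans[of 0 "1 / \<mu>"])
        have "1 \<le> \<mu> * \<tau>" using \<tau> \<mu> by (auto simp: field_simps)
        then have "2 \<le> exp (\<mu> * \<tau>)" using exp_ge_add_one_self[of "\<mu> * \<tau>"] by linarith
        then have "2 * L (t - \<tau>) \<le> exp (\<mu> * \<tau>) * L (t - \<tau>)"
          using L_pos[of "t - \<tau>"] by (intro mult_right_mono) auto
        also have "\<dots> = L t" by (simp add: L_def exp_diff right_diff_distrib)
        finally have "L t / 2 \<le> L t - L (max 0 (t - \<tau>))" using \<tau> True by (simp add: max_absorb2)
        then have "L t / 2 * \<psi> \<le> (L t - L (max 0 (t - \<tau>))) * \<psi>"
          using \<psi> by (intro mult_right_mono) auto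
        then show ?thesis using G_ge[of \<tau>] \<tau>_pos by (simp add: c_def)
      qed
      have "3 * (\<Gamma> * C1 * (L t * \<psi>)) = c * (6 * \<Gamma> * C1)"
        by (simp add: c_def)
      also have "\<dots> \<le> c * (\<mu> powr \<alpha> * (1 - 2 powr (- \<alpha>)))"
        using c \<mu> by (intro mult_left_mono) auto
      also have "\<dots> = c * ((1 / \<mu>) powr (- \<alpha>) - (2 / \<mu>) powr (- \<alpha>))"
        using \<mu> by (simp add: powr_divide powr_minus field_simps)
      also have "\<dots> \<le> c * ((1 / \<mu>) powr (- \<alpha>) - (2 / \<mu>) powr (- \<alpha>))
          + (?f t - ?f 0 - (?g s - ?g 0)) * T powr (- \<alpha>)"
        using initial c by simp
      also have "\<dots> \<le> tail_op \<alpha> T r ?f t - tail_op \<alpha> T r ?g s"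
        by (rule tail_op_diff_ge[OF \<alpha>(1) cf cg])
          (use r ts True \<mu> nonneg ge in \<open>auto simp: divide_right_mono\<close>)
      finally show ?thesis .
    next
      case False
      \<comment> \<open>For \<tau> \<ge> w both shifted times are 0, and the increment is the jump
        from the initial data. From t < 2 / \<mu> and d \<le> 1 / \<mu> one gets w \<le> 3 /
        \<mu>.\<close>
      define w where "w = max t s"
      have w: "0 < w" "w \<le> T" "w \<le> 3 / \<mu>" "r \<le> w"
        using False close d ts t_pos r by (auto simp: w_def)
      have ge: "c \<le> ?G \<tau>" if \<tau>: "\<tau> \<in> {w..T}" for \<tau>
        using \<tau> initial by (simp add: w_def max_absorb1)
      have "3 * (\<Gamma> * C1 * (L t * \<psi>)) = c * (6 * \<Gamma> * C1)"
        by (simp add: c_def)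
      also have "\<dots> \<le> c * (\<mu> / 3) powr \<alpha>"
        using c \<mu> by (intro mult_left_mono) auto
      also have "\<dots> = c * (3 / \<mu>) powr (- \<alpha>)"
        using \<mu> by (simp add: powr_divide powr_minus field_simps)
      also have "\<dots> \<le> c * w powr (- \<alpha>)"
        using w c \<alpha> by (intro mult_left_mono powr_mono2') auto
      also have "\<dots> = c * (w powr (- \<alpha>) - T powr (- \<alpha>)) + c * T powr (- \<alpha>)"
        by (simp add: algebra_simps)
      \<comment> \<open>The boundary term carries the same initial jump, so it makes up for the
        kernel mass beyond T.\<close>
      also have "\<dots> \<le> c * (w powr (- \<alpha>) - T powr (- \<alpha>))
          + (?f t - ?f 0 - (?g s - ?g 0)) * T powr (- \<alpha>)"
        using initial by (intro add_left_mono mult_right_mono) auto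
      also have "\<dots> \<le> tail_op \<alpha> T r ?f t - tail_op \<alpha> T r ?g s"
        by (rule tail_op_diff_ge[OF \<alpha>(1) cf cg]) (use r ts w nonneg ge in auto)
      finally show ?thesis .
    qed
    ultimately show False by linarith
  qed
  then show ?thesis using that L_pos by blast
qed

subsection \<open>The Hoelder estimate in time\<close>

text \<open>The linear terms of the tangent bounds for the increments - \<tau> and \<tau>
  cancel.\<close>

lemma powr_symmetric_difference_nonneg:
  fixes h \<tau> a :: real
  assumes "0 < h" "0 \<le> \<tau>" "\<tau> \<le> h" "0 < a" "a < 1"
  shows "0 \<le> 2 * h powr a - (h - \<tau>) powr a - (h + \<tau>) powr a"
  using powr_add_le_linear[of h "- \<tau>" a] powr_add_le_linear[of h \<tau> a] assms by simp

text \<open>For \<tau> = h the value is (2 - 2^a) h^a, positive as a < 1. The constant c is half of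
  this factor, and \<theta> solves (1 - \<theta>)^a = c, so (h - \<tau>)^a uses up at most the other
  half.\<close>

lemma powr_symmetric_difference_ge:
  fixes a :: real
  assumes "0 < a" "a < 1"
  obtains \<theta> c where "0 < \<theta>" "\<theta> < 1" "0 < c"
    "\<And>h \<tau>. 0 < h \<Longrightarrow> \<theta> * h \<le> \<tau> \<Longrightarrow> \<tau> \<le> h \<Longrightarrow>
        c * h powr a \<le> 2 * h powr a - (h - \<tau>) powr a - (h + \<tau>) powr a"
proof -
  define c where "c = (2 - 2 powr a) / 2"
  have "(2::real) powr a < 2 powr 1" "(2::real) powr 0 < 2 powr a"
    using assms by (intro powr_less_mono; simp)+
  then have c: "0 < c" "c < 1" by (auto simp: c_def)
  define \<theta> where "\<theta> = 1 - c powr (1 / a)"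
  have "c powr (1 / a) < 1 powr (1 / a)" using c assms by (intro powr_less_mono2) auto
  then have \<theta>: "0 < \<theta>" "\<theta> < 1" using c by (auto simp: \<theta>_def)
  have "c * h powr a \<le> 2 * h powr a - (h - \<tau>) powr a - (h + \<tau>) powr a"
    if "0 < h" "\<theta> * h \<le> \<tau>" "\<tau> \<le> h" for h \<tau>
  proof -
    have "(h - \<tau>) powr a \<le> (c powr (1 / a) * h) powr a"
      using that assms by (intro powr_mono2) (auto simp: \<theta>_def algebra_simps)
    also have "\<dots> = c * h powr a"
      using that assms c by (simp add: powr_mult powr_powr)
    finally have 1: "(h - \<tau>) powr a \<le> c * h powr a" .
    have "0 \<le> \<theta> * h" using that \<theta> by simp
    then have "(h + \<tau>) powr a \<le> (2 * h) powr a"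
      using that assms by (intro powr_mono2) auto
    also have "\<dots> = (2 - 2 * c) * h powr a"
      using that by (simp add: powr_mult c_def field_simps)
    finally show ?thesis using 1 by (simp add: algebra_simps)
  qed
  then show ?thesis using that \<theta> c by blast
qed

text \<open>The spatial bound limits the gradient at a maximum to \<Lambda>, so the equations bound
  the tail operators independently of \<open>C\<close>. Concavity of the time penalty makes their
  difference at least \<open>C * \<kappa>\<close>.\<close>

lemma time_holder:
  fixes u :: "real \<Rightarrow> real^'n \<Rightarrow> real" and b :: "real \<Rightarrow> real^'n \<Rightarrow> real^'n"
  assumes T: "0 < T" and \<alpha>: "0 < \<alpha>" "\<alpha> < 1"
    and contb: "continuous_on ({0..T} \<times> UNIV) (\<lambda>(t,x). b t x)" and perb: "periodic_tx b"
    and contu: "continuous_on ({0..T} \<times> UNIV) (\<lambda>(t,x). u t x)" and peru: "periodic_tx u"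
    and sub: "visc_sub \<alpha> T (\<lambda>t x r p. b t x \<bullet> p) u"
    and super: "visc_super \<alpha> T (\<lambda>t x r p. b t x \<bullet> p) u"
    and \<Lambda>: "0 < \<Lambda>" and lip: "\<And>t x y. t \<in> {0..T} \<Longrightarrow> u t x - u t y \<le> \<Lambda> * norm (x - y)"
  obtains C where "0 < C"
    "\<And>t s x y. t \<in> {0..T} \<Longrightarrow> s \<in> {0..T} \<Longrightarrow>
        u t x - u s y \<le> \<Lambda> * norm (x - y) + C * \<bar>t - s\<bar> powr \<alpha>"
proof -
  define \<Gamma> where "\<Gamma> = Gamma (1 - \<alpha>)"
  have \<Gamma>: "0 < \<Gamma>" unfolding \<Gamma>_def using \<alpha> by (intro Gamma_real_pos) auto
  obtain B where B: "0 < B" "\<And>t x. t \<in> {0..T} \<Longrightarrow> norm (b t x) \<le> B"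
    using periodic_tx_bounded[OF contb perb] by blast
  obtain \<theta> c where \<theta>: "0 < \<theta>" "\<theta> < 1" and c: "0 < c"
    and diff_ge: "\<And>h \<tau>. 0 < h \<Longrightarrow> \<theta> * h \<le> \<tau> \<Longrightarrow> \<tau> \<le> h \<Longrightarrow>
        c * h powr \<alpha> \<le> 2 * h powr \<alpha> - (h - \<tau>) powr \<alpha> - (h + \<tau>) powr \<alpha>"
    using powr_symmetric_difference_ge[OF \<alpha>] by metis
  define \<kappa> where "\<kappa> = c * (\<theta> powr (- \<alpha>) - 1)"
  have "1 < \<theta> powr (- \<alpha>)"
    using powr_less_mono2_neg[of "- \<alpha>" \<theta> 1] \<theta> \<alpha> by simp
  then have \<kappa>: "0 < \<kappa>" using c by (simp add: \<kappa>_def)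
  \<comment> \<open>The equations allow a difference of at most
    \<open>2 * \<Gamma> * B * \<Lambda> + 1\<close>, which \<open>C * \<kappa>\<close> exceeds by
    1.\<close>
  define C where "C = (2 * \<Gamma> * B * \<Lambda> + 2) / \<kappa>"
  have C: "0 < C" using \<kappa> \<Gamma> B \<Lambda> by (auto simp: C_def intro!: divide_pos_pos add_pos_pos)
  define P where "P t s = C * \<bar>t - s\<bar> powr \<alpha>" for t s :: real
  have P_nonneg: "0 \<le> P t s" for t s using C by (simp add: P_def)
  have P_mono: "P t s \<le> P t' s'" if "\<bar>t - s\<bar> \<le> \<bar>t' - s'\<bar>" for t s t' s'
    unfolding P_def using that C \<alpha> by (intro mult_left_mono powr_mono2) auto
  have "u t0 x0 - u s0 y0 \<le> \<Lambda> * norm (x0 - y0) + C * \<bar>t0 - s0\<bar> powr \<alpha>"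
    if ts0: "t0 \<in> {0..T}" "s0 \<in> {0..T}" for t0 s0 x0 y0
  proof (rule ccontr)
    assume "\<not> ?thesis"
    then have gap: "0 < u t0 x0 - u s0 y0 - \<Lambda> * norm (x0 - y0) - P t0 s0"
      by (simp add: P_def)
    define \<eta> where "\<eta> = (u t0 x0 - u s0 y0 - \<Lambda> * norm (x0 - y0) - P t0 s0) / (2 * \<Lambda>)"
    have \<eta>: "0 < \<eta>" using gap \<Lambda> by (simp add: \<eta>_def)
    let ?L = "\<lambda>t::real. \<Lambda>"
    have "\<Lambda> * smooth_norm \<eta> (x0 - y0) \<le> \<Lambda> * norm (x0 - y0) + \<Lambda> * \<eta>"
      using mult_left_mono[OF smooth_norm_le[of \<eta> "x0 - y0"], of \<Lambda>] \<eta> \<Lambda> by (simp add: distrib_left)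
    moreover have "2 * (\<Lambda> * \<eta>) = u t0 x0 - u s0 y0 - \<Lambda> * norm (x0 - y0) - P t0 s0"
      using \<Lambda> by (simp add: \<eta>_def)
    ultimately have "0 < doubled u u ?L P \<eta> t0 s0 x0 y0"
      using gap unfolding doubled_def by linarith
    moreover have "continuous_on {0..T} ?L" by (intro continuous_intros)
    moreover have "continuous_on ({0..T} \<times> {0..T}) (\<lambda>(t,s). P t s)"
      unfolding P_def case_prod_unfold using \<alpha> by (intro continuous_intros continuous_on_powr') auto
    ultimately obtain t s x y where ts: "t \<in> {0..T}" "s \<in> {0..T}"
      and pos: "0 < doubled u u ?L P \<eta> t s x y"
      and max: "\<And>t' s' x' y'. t' \<in> {0..T} \<Longrightarrow> s' \<in> {0..T} \<Longrightarrow>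
        doubled u u ?L P \<eta> t' s' x' y' \<le> doubled u u ?L P \<eta> t s x y"
      using doubled_attains_max[OF contu peru contu peru, of ?L \<Lambda> P t0 s0 \<eta> x0 y0] \<Lambda> ts0 P_nonneg
      by (metis order_refl)
    define h where "h = \<bar>t - s\<bar>"
    \<comment> \<open>For equal times \<open>P\<close> vanishes and the spatial bound excludes a
      positive value. Hence h > 0, where the penalty has a finite slope m.\<close>
    have "t \<noteq> s"
    proof
      assume "t = s"
      then have "\<Lambda> * smooth_norm \<eta> (x - y) < u t x - u t y"
        using pos by (simp add: doubled_def P_def)
      then show False
        using lip[OF ts(1), of x y] mult_left_mono[OF smooth_norm_ge_norm[of "x - y" \<eta>], of \<Lambda>] \<Lambda>
        by linarith
    qed
    then have h: "0 < h" "h \<le> T" using ts by (auto simp: h_def)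
    define m where "m = C * (\<alpha> * h powr (\<alpha> - 1))"
    have P_le: "P t' s' \<le> P t s + m * e" if "\<bar>t' - s'\<bar> \<le> h + e" "0 \<le> e" for t' s' e
    proof -
      have "\<bar>t' - s'\<bar> powr \<alpha> \<le> (h + e) powr \<alpha>"
        using that \<alpha> by (intro powr_mono2) auto
      also have "\<dots> \<le> h powr \<alpha> + \<alpha> * h powr (\<alpha> - 1) * e"
        using that \<alpha> h by (intro powr_add_le_linear) auto
      finally have "C * \<bar>t' - s'\<bar> powr \<alpha> \<le> C * (h powr \<alpha> + \<alpha> * h powr (\<alpha> - 1) * e)"
        using C by (intro mult_left_mono) auto
      then show ?thesis by (simp add: P_def m_def h_def algebra_simps)
    qed
    \<comment> \<open>A time equal to 0 imposes no restriction on r, hence the default 1. The bound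
      by \<open>\<theta> * h\<close> puts the window \<open>{\<theta> * h..h}\<close> inside the
      range.\<close>
    define \<rho> where "\<rho> = min (\<theta> * h) (min (if 0 < t then t else 1) (if 0 < s then s else 1))"
    have "0 < \<rho>" using \<theta> h by (simp add: \<rho>_def)
    then obtain r where r: "0 < r" "r \<le> \<rho>" and small: "\<alpha> * m / (1 - \<alpha>) * r powr (1 - \<alpha>) < 1 / 2"
      using small_powr[of "1 / 2" "1 - \<alpha>"] \<alpha> by (metis diff_gt_0_iff_gt half_gt_zero_iff zero_less_one)
    have r_h: "r \<le> \<theta> * h" and r_t: "0 < t \<Longrightarrow> r \<le> t" and r_s: "0 < s \<Longrightarrow> r \<le> s"
      using r by (auto simp: \<rho>_def)
    have \<theta>_h: "\<theta> * h \<le> h" using \<theta> h by simp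
    let ?f = "\<lambda>s. u s x" and ?g = "\<lambda>s. u s y"
    let ?p = "(\<Lambda> / smooth_norm \<eta> (x - y)) *\<^sub>R (x - y)"
    have bp: "\<bar>\<Gamma> * (b t' z \<bullet> ?p)\<bar> \<le> \<Gamma> * B * \<Lambda>" if "t' \<in> {0..T}" for t' z
    proof -
      have "\<bar>b t' z \<bullet> ?p\<bar> \<le> norm (b t' z) * norm ?p"
        by (rule Cauchy_Schwarz_ineq2)
      also have "\<dots> \<le> B * \<Lambda>"
        using B that norm_smooth_norm_gradient_le[OF \<eta> less_imp_le[OF \<Lambda>]] by (intro mult_mono) auto
      finally have "\<Gamma> * \<bar>b t' z \<bullet> ?p\<bar> \<le> \<Gamma> * (B * \<Lambda>)"
        using \<Gamma> by (intro mult_left_mono) auto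
      then show ?thesis
        using \<Gamma> by (simp only: abs_mult abs_of_pos mult.assoc)
    qed
    have lo: "tail_op \<alpha> T r ?f t \<le> \<Gamma> * B * \<Lambda> + 1 / 2"
    proof (cases "0 < t")
      case True
      have "P t' s \<le> P t s + m * (t - t')" if "t' \<in> {0..t}" for t'
        using that by (intro P_le) (auto simp: h_def)
      then have "tail_op \<alpha> T r ?f t + \<Gamma> * (b t x \<bullet> ?p) \<le> \<alpha> * m / (1 - \<alpha>) * r powr (1 - \<alpha>)"
        unfolding \<Gamma>_def
        using doubled_max_subsolution[OF \<alpha> contu sub \<eta>, of ?L t P s m u x y] max ts True r r_t \<Lambda>
        by simp
      then show ?thesis using bp[OF ts(1), of x] small by linarith
    next
      case False
      then have "t = 0" using ts by simp
      then show ?thesis using r mult_pos_pos[OF mult_pos_pos[OF \<Gamma> B(1)] \<Lambda>] by simp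
    qed
    have hi: "- (\<Gamma> * B * \<Lambda> + 1 / 2) \<le> tail_op \<alpha> T r ?g s"
    proof (cases "0 < s")
      case True
      have "P t s' \<le> P t s + m * (s - s')" if "s' \<in> {0..s}" for s'
        using that by (intro P_le) (auto simp: h_def)
      then have "- (\<alpha> * m / (1 - \<alpha>) * r powr (1 - \<alpha>)) \<le> tail_op \<alpha> T r ?g s + \<Gamma> * (b s y \<bullet> ?p)"
        unfolding \<Gamma>_def
        using doubled_max_supersolution[OF \<alpha> contu super \<eta>, of ?L t s P m u x y] max ts True r r_s \<Lambda>
        by simp
      then show ?thesis using bp[OF ts(2), of y] small by linarith
    next
      case False
      then have "s = 0" using ts by simp
      then show ?thesis using r mult_pos_pos[OF mult_pos_pos[OF \<Gamma> B(1)] \<Lambda>] by simp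
    qed
    let ?G = "\<lambda>\<tau>. ?f t - ?f (max 0 (t - \<tau>)) - (?g s - ?g (max 0 (s - \<tau>)))"
    have sync: "P t s - P (max 0 (t - \<tau>)) (max 0 (s - \<tau>)) \<le> ?G \<tau>" if "0 \<le> \<tau>" for \<tau>
      using max[of "max 0 (t - \<tau>)" "max 0 (s - \<tau>)" x y] that ts by (simp add: doubled_def)
    \<comment> \<open>Add the maximum inequalities obtained by moving t alone and s alone.\<close>
    have indep: "2 * P t s - P (max 0 (t - \<tau>)) s - P t (max 0 (s - \<tau>)) \<le> ?G \<tau>" if "0 \<le> \<tau>" for \<tau>
      using max[of "max 0 (t - \<tau>)" s x y] max[of t "max 0 (s - \<tau>)" x y] that ts
      by (simp add: doubled_def)
    \<comment> \<open>Moving the later time back leaves distance h - \<tau>. Moving the earlier one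
      back gives at most h + \<tau>, less if it is truncated at 0.\<close>
    have near: "C * (2 * h powr \<alpha> - (h - \<tau>) powr \<alpha> - (h + \<tau>) powr \<alpha>) \<le> ?G \<tau>"
      if \<tau>: "0 \<le> \<tau>" "\<tau> \<le> h" for \<tau>
    proof -
      have "P (max 0 (t - \<tau>)) s + P t (max 0 (s - \<tau>)) \<le> P (h - \<tau>) 0 + P (h + \<tau>) 0"
      proof (cases "s < t")
        case True
        then show ?thesis
          using \<tau> ts by (intro add_mono P_mono) (auto simp: h_def)
      next
        case False
        then show ?thesis
          using \<tau> ts by (subst add.commute[of "P (h - \<tau>) 0"], intro add_mono P_mono) (auto simp: h_def)
      qed
      then show ?thesis
        using indep[OF \<tau>(1)] \<tau> h by (simp add: P_def h_def right_diff_distrib)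
    qed
    have nonneg: "0 \<le> ?G \<tau>" if "\<tau> \<in> {r..T}" for \<tau>
    proof (cases "\<tau> \<le> h")
      case True
      then have "0 \<le> C * (2 * h powr \<alpha> - (h - \<tau>) powr \<alpha> - (h + \<tau>) powr \<alpha>)"
        using that r h \<alpha> C by (intro mult_nonneg_nonneg powr_symmetric_difference_nonneg) auto
      then show ?thesis using near[of \<tau>] True that r by auto
    next
      \<comment> \<open>For \<tau> > h the later time would pass the other one, so the common shift
        is used instead.\<close>
      case False
      then show ?thesis
        using sync[of \<tau>] h P_mono[OF abs_max_diff_le, of t \<tau> s] by linarith
    qed
    have ge: "C * (c * h powr \<alpha>) \<le> ?G \<tau>" if "\<tau> \<in> {\<theta> * h..h}" for \<tau>
    proof -
      have "0 \<le> \<tau>" using that \<theta> h by (auto intro: order_trans[of 0 "\<theta> * h"])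
      have "C * (c * h powr \<alpha>) \<le> C * (2 * h powr \<alpha> - (h - \<tau>) powr \<alpha> - (h + \<tau>) powr \<alpha>)"
        using that h C by (intro mult_left_mono diff_ge) auto
      also have "\<dots> \<le> ?G \<tau>"
        using \<open>0 \<le> \<tau>\<close> that by (intro near) auto
      finally show ?thesis .
    qed
    have cont: "continuous_on {0..T} (\<lambda>s. u s z)" for z
      using continuous_on_compose2[OF contu, of "{0..T}" "\<lambda>s. (s, z)"]
      by (force intro!: continuous_intros)
    have "2 * \<Gamma> * B * \<Lambda> + 2 = C * \<kappa>" using \<kappa> by (simp add: C_def)
    \<comment> \<open>The powers of h cancel, so the lower bound, and with it \<open>C\<close>, does
      not depend on h.\<close>
    also have "\<dots> = C * (c * h powr \<alpha>) * ((\<theta> * h) powr (- \<alpha>) - h powr (- \<alpha>))"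
      using h \<theta> by (simp add: \<kappa>_def powr_mult powr_minus field_simps)
    also have "\<dots> \<le> C * (c * h powr \<alpha>) * ((\<theta> * h) powr (- \<alpha>) - h powr (- \<alpha>))
        + (?f t - ?f 0 - (?g s - ?g 0)) * T powr (- \<alpha>)"
      \<comment> \<open>At \<tau> = T both shifted times are 0, so nonnegativity there is the sign
        of the boundary term.\<close>
      using nonneg[of T] ts h r_h \<theta>_h by (simp add: max_absorb1)
    also have "\<dots> \<le> tail_op \<alpha> T r ?f t - tail_op \<alpha> T r ?g s"
      by (rule tail_op_diff_ge[OF \<alpha>(1) cont cont]) (use r r_h h \<theta>_h ts nonneg ge in auto)
    finally show False using lo hi by simp
  qed
  then show ?thesis using that C by blast
qed

section \<open>Uniqueness and joint regularity\<close>

theorem theorem1p1: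
  fixes T \<alpha> C1 C2 :: real
    and b :: "real \<Rightarrow> real^'n \<Rightarrow> real^'n"
    and u0 :: "real^'n \<Rightarrow> real"
  assumes "0 < T" and "0 < \<alpha>" and "\<alpha> < 1"
    and "continuous_on ({0..T} \<times> UNIV) (\<lambda>(t,x). b t x)" and "periodic_tx b"
    and "periodic_x u0"
    and "C1 > 0" and "C2 > 0"
    and "\<And>t x y. t \<in> {0<..T} \<Longrightarrow> norm (b t x - b t y) \<le> C1 * norm (x - y)"
    and "\<And>x y. \<bar>u0 x - u0 y\<bar> \<le> C2 * norm (x - y)"
  shows "(\<forall>u v. visc_sol_ivp \<alpha> T (\<lambda>t x r p. b t x \<bullet> p) u0 u \<and>
                 visc_sol_ivp \<alpha> T (\<lambda>t x r p. b t x \<bullet> p) u0 v \<longrightarrow>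
                 (\<forall>t\<in>{0..T}. \<forall>x. u t x = v t x))
       \<and> (\<forall>u. visc_sol_ivp \<alpha> T (\<lambda>t x r p. b t x \<bullet> p) u0 u \<longrightarrow>
              (\<exists>C3>0. \<forall>t\<in>{0..T}. \<forall>s\<in>{0..T}. \<forall>x y.
                  \<bar>u t x - u s y\<bar> \<le> C3 * (\<bar>t - s\<bar> powr \<alpha> + norm (x - y))))"
proof -
  let ?sol = "visc_sol_ivp \<alpha> T (\<lambda>t x r p. b t x \<bullet> p) u0"
  have comparison: "\<exists>\<Lambda>>0. \<forall>t\<in>{0..T}. \<forall>x y. u t x - v t y \<le> \<Lambda> * norm (x - y)"
    if "?sol u" "?sol v" for u v
  proof -
    have init: "u 0 x - v 0 y \<le> C2 * norm (x - y)" for x y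
      using that assms(10)[of x y] by (simp add: visc_sol_ivp_def)
    have u: "continuous_on ({0..T} \<times> UNIV) (\<lambda>(t,x). u t x)" "periodic_tx u"
        "visc_sub \<alpha> T (\<lambda>t x r p. b t x \<bullet> p) u"
      and v: "continuous_on ({0..T} \<times> UNIV) (\<lambda>(t,x). v t x)" "periodic_tx v"
        "visc_super \<alpha> T (\<lambda>t x r p. b t x \<bullet> p) v"
      using that by (simp_all add: visc_sol_ivp_def)
    show ?thesis
    proof (rule spatial_comparison[OF assms(1-5,7,8) _ u(1,2) v(1,2) u(3) v(3) init])
      show "norm (b t x - b t y) \<le> C1 * norm (x - y)" if "t \<in> {0<..T}" for t x y
        using that by (rule assms(9))
    qed blast
  qed
  have unique: "u t x \<le> v t x" if uv: "?sol u" "?sol v" and t: "t \<in> {0..T}" for u v t x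
  proof -
    obtain \<Lambda> where "u t x - v t x \<le> \<Lambda> * norm (x - x)"
      using comparison[OF uv] t by blast
    then show ?thesis by simp
  qed
  have holder: "\<exists>C3>0. \<forall>t\<in>{0..T}. \<forall>s\<in>{0..T}. \<forall>x y.
      \<bar>u t x - u s y\<bar> \<le> C3 * (\<bar>t - s\<bar> powr \<alpha> + norm (x - y))" if sol: "?sol u" for u
  proof -
    obtain \<Lambda> where \<Lambda>: "0 < \<Lambda>" "\<And>t x y. t \<in> {0..T} \<Longrightarrow> u t x - u t y \<le> \<Lambda> * norm (x - y)"
      using comparison[OF sol sol] by blast
    have u: "continuous_on ({0..T} \<times> UNIV) (\<lambda>(t,x). u t x)" "periodic_tx u"
        "visc_sub \<alpha> T (\<lambda>t x r p. b t x \<bullet> p) u" "visc_super \<alpha> T (\<lambda>t x r p. b t x \<bullet> p) u"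
      using sol by (simp_all add: visc_sol_ivp_def)
    obtain C where C: "0 < C" "\<And>t s x y. t \<in> {0..T} \<Longrightarrow> s \<in> {0..T} \<Longrightarrow>
        u t x - u s y \<le> \<Lambda> * norm (x - y) + C * \<bar>t - s\<bar> powr \<alpha>"
      using time_holder[OF assms(1-5) u \<Lambda>] by blast
    have "\<bar>u t x - u s y\<bar> \<le> max \<Lambda> C * (\<bar>t - s\<bar> powr \<alpha> + norm (x - y))"
      if "t \<in> {0..T}" "s \<in> {0..T}" for t s x y
    proof -
      \<comment> \<open>The one-sided estimate is applied to the two points in both orders.\<close>
      have "\<bar>u t x - u s y\<bar> \<le> \<Lambda> * norm (x - y) + C * \<bar>t - s\<bar> powr \<alpha>"
        using C(2)[OF that, of x y] C(2)[OF that(2,1), of y x]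
        by (simp add: abs_le_iff norm_minus_commute abs_minus_commute)
      also have "\<dots> \<le> max \<Lambda> C * norm (x - y) + max \<Lambda> C * \<bar>t - s\<bar> powr \<alpha>"
        by (intro add_mono mult_right_mono) auto
      finally show ?thesis by (simp add: distrib_left)
    qed
    then show ?thesis using \<Lambda>(1) by (intro exI[of _ "max \<Lambda> C"]) auto
  qed
  show ?thesis
    using unique holder by (meson order_antisym)
qed

end
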